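(* There does not exist any real Hausdorff topological vector space $(G,+,\cdot,\sigma)$ such that: (i) $(G,+,\cdot)$ is a linear subspace of $\mathcal{GD}_K(U)$ for some non-empty functionally compact set $K\subseteq U\subseteq\widetilde{\mathbb{R}}^n$, where $U$ is a sharply open set; (ii) $G$ contains the Dirac delta, $\delta\in G$; (iii) there exist $m\in\mathbb{N}$ and $\rho\in\widetilde{\mathbb{R}}_{>0}$ such that $\rho<1$ and $B^m_\rho(0)\cap G\in\sigma$. In particular, the Colombeau algebra $\mathcal{G}^s(\Omega)$ does not contain any real Hausdorff topological vector subspace $G$ such that some $B^m_\rho(0)\cap G$ (with $m\in\mathbb{N}$, $\rho\in\widetilde{\mathbb{R}}_{>0}$, $\rho<1$) is open and $\delta\in G$.
   Context: Generalized numbers: $I=(0,1]$; nets are indexed by $\varepsilon\in I$; "for $\varepsilon$ small" means for all $\varepsilon\in(0,\varepsilon_0]$ for some $\varepsilon_0\in I$. A net $(x_\varepsilon)$ in $\mathbb{R}^n$ is moderate if $|x_\varepsilon|=O(\varepsilon^{-N})$ as $\varepsilon\to0$ for some $N\in\mathbb{N}$; $(x_\varepsilon)\sim(y_\varepsilon)$ iff $|x_\varepsilon-y_\varepsilon|=O(\varepsilon^m)$ for all $m\in\mathbb{N}$. $\widetilde{\mathbb{R}}^n$ is the set of classes $[x_\varepsilon]$ of moderate nets in $\mathbb{R}^n$; $\widetilde{\mathbb{R}}$ is a ring containing $\mathbb{R}$ (constant nets). $x\le y$ iff there are representatives with $x_\varepsilon\le y_\varepsilon$ for $\varepsilon$ small;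 $x<y$ means $x\le y$ and $y-x$ invertible. $|[x_\varepsilon]|:=[|x_\varepsilon|]$. The sharp topology on $\widetilde{\mathbb{R}}^n$ is generated by the balls $\{y : |y-x|<\rho\}$, $x\in\widetilde{\mathbb{R}}^n$, $\rho\in\widetilde{\mathbb{R}}_{>0}$. Sets: for a net $(A_\varepsilon)$ of subsets of $\mathbb{R}^n$, $[A_\varepsilon]:=\{[x_\varepsilon]\in\widetilde{\mathbb{R}}^n : x_\varepsilon\in A_\varepsilon\text{ for }\varepsilon\text{ small}\}$, and $\langle A_\varepsilon\rangle$ is the set of those $[x_\varepsilon]\in\widetilde{\mathbb{R}}^n$ such that every representative satisfies $x_\varepsilon\in A_\varepsilon$ for $\varepsilon$ small. $K\subseteq\widetilde{\mathbb{R}}^n$ is functionally compact if $K=[K_\varepsilon]$ for a net of compact sets $K_\varepsilon\subseteq\mathbb{R}^n$ such that, for some $N\in\mathbb{R}_{>0}$, $\sup_{x\in K_\varepsilon}|x|\le\varepsilon^{-N}$ for $\varepsilon$ small. Generalized smooth functions: for $X\subseteq\widetilde{\mathbb{R}}^n$ and $Y\subseteq\widetilde{\mathbb{R}}^d$, $f:X\to Y$ is in $\mathcal{G}^\infty(X,Y)$ if there is a net $u_\varepsilon\in C^\infty(\Omega_\varepsilon,\mathbb{R}^d)$ ($\Omega_\varepsilon\subseteq\mathbb{R}^n$ open) defining $f$, i.e. $X\subseteq\langle\Omega_\varepsilon\rangle$, $f([x_\varepsilon])=[u_\varepsilon(x_\varepsilon)]\in Y$ and $(\partial^\alpha u_\varepsilon(x_\varepsilon))$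 is moderate for all $[x_\varepsilon]\in X$, $\alpha\in\mathbb{N}^n$. If $X$ is sharply open, $\partial^\alpha f([x_\varepsilon]):=[\partial^\alpha u_\varepsilon(x_\varepsilon)]$. Compact supports: $\mathrm{ext}(K):=\{x\in\widetilde{\mathbb{R}}^n : \forall a\in K,\ |x-a|>0\}$. For non-empty functionally compact $K\subseteq U$, $\mathcal{GD}_K(U)$ is the set of $f\in\mathcal{G}^\infty(U,\widetilde{\mathbb{R}})$ having a defining net $u_\varepsilon\in C^\infty(\mathbb{R}^n,\mathbb{R})$ with $[\partial^\alpha u_\varepsilon(x_\varepsilon)]=0$ for all $\alpha\in\mathbb{N}^n$ and all $[x_\varepsilon]\in\mathrm{ext}(K)$. For $U$ sharply open, $f\in\mathcal{GD}_K(U)$ and $m\in\mathbb{N}$, set $\|f\|_m:=\max_{|\alpha|\le m}\max(|\partial^\alpha f(M_\alpha)|,|\partial^\alpha f(m_\alpha)|)\in\widetilde{\mathbb{R}}$, where $m_\alpha,M_\alpha\in K$ are points with $\partial^\alpha f(m_\alpha)\le\partial^\alpha f(x)\le\partial^\alpha f(M_\alpha)$ for all $x\in K$ (such points exist, and $\|f\|_m$ depends neither on their choice nor on $K$). For $\rho\in\widetilde{\mathbb{R}}_{>0}$, $B^m_\rho(0):=\{g\in\mathcal{GD}_K(U) : \|g\|_m<\rho\}$. Colombeau algebra: $\Omega\subseteq\mathbb{R}^n$ is open. $\mathcal{G}^s(\Omega)$ is the special Colombeau algebra: nets of smooth functions on $\Omega$ such that, for each compact subset and each derivative, there is $N\in\mathbb{N}$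 with that derivative $O(\varepsilon^{-N})$ uniformly on that compact set, modulo nets all of whose derivatives are $O(\varepsilon^m)$ uniformly on compact sets for all $m\in\mathbb{N}$. It is identified with $\mathcal{G}^\infty(\widetilde{\Omega}_c,\widetilde{\mathbb{R}})$, where $\widetilde{\Omega}_c$ is the set of classes of nets in $\Omega$ that lie in some fixed compact subset of $\Omega$ for $\varepsilon$ small. Elements of $\mathcal{G}^s(\Omega)$ are viewed as compactly supported generalized smooth functions by means of the following fact: if $J=[J_\varepsilon]\in\widetilde{\mathbb{R}}$ with $J_\varepsilon\to+\infty$ as $\varepsilon\to0^+$, and $K:=[\{x\in\Omega : |x|\le J_\varepsilon\}]$, then every $f\in\mathcal{G}^\infty(\widetilde{\Omega}_c,\widetilde{\mathbb{R}})$ is the restriction to $\widetilde{\Omega}_c$ of some $\bar f\in\mathcal{GD}_K(\widetilde{\mathbb{R}}^n)$; the ball $B^m_\rho(0)$ in the last sentence of the claim is to be read in this sense. $\delta$ denotes the Dirac delta regarded as a generalized function through a standard embedding of Schwartz distributions by convolution with a mollifier. A real Hausdorff topological vector space is a Hausdorff topological vector space over $\mathbb{R}$ with its usual Euclidean topology.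
   Formalization: δ ∈ G in (ii) is read as: δ lies in GD_K(R̃ⁿ) and its restriction to U lies in G; in the last sentence 0 ∈ Ω is assumed. Otherwise δ may restrict to 0 (U or Ω away from 0) and G = {0} is a counterexample. *)

theory Defs
  imports "HOL-Analysis.Analysis" "HOL-Library.Landau_Symbols" "HOL-Library.Function_Algebras"
begin

section \<open>Generalized points and generalized numbers\<close>

text \<open>Nets indexed by \<open>(0,1]\<close> are functions on \<open>real\<close>; only their germ at \<open>0\<^sup>+\<close> matters, so ``for
  \<open>\<epsilon>\<close> small'' is \<open>eventually _ (at_right 0)\<close>.\<close>

definition moderate :: "(real \<Rightarrow> 'a::real_normed_vector) \<Rightarrow> bool" where
  "moderate x \<longleftrightarrow> (\<exists>N::nat. (\<lambda>\<epsilon>. norm (x \<epsilon>)) \<in> O[at_right 0](\<lambda>\<epsilon>. (1 / \<epsilon>) ^ N))"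

definition null_net :: "(real \<Rightarrow> 'a::real_normed_vector) \<Rightarrow> bool" where
  "null_net x \<longleftrightarrow> (\<forall>m::nat. (\<lambda>\<epsilon>. norm (x \<epsilon>)) \<in> O[at_right 0](\<lambda>\<epsilon>. \<epsilon> ^ m))"

definition net_equiv :: "(real \<Rightarrow> 'a::real_normed_vector) \<Rightarrow> (real \<Rightarrow> 'a) \<Rightarrow> bool" where
  "net_equiv x y \<longleftrightarrow> moderate x \<and> moderate y \<and> null_net (\<lambda>\<epsilon>. x \<epsilon> - y \<epsilon>)"

lemma bigo_norm_le:
  assumes "\<And>\<epsilon>. norm (x \<epsilon>) \<le> norm (y \<epsilon>)" "(\<lambda>\<epsilon>. norm (y \<epsilon>)) \<in> O[F](g :: real \<Rightarrow> real)"
  shows "(\<lambda>\<epsilon>. norm (x \<epsilon>)) \<in> O[F](g)"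
  by (rule landau_o.big_trans[OF bigoI[where c = 1] assms(2)]) (simp add: assms(1))

lemma moderate_power_mono:
  assumes "(N::nat) \<le> M"
  shows "(\<lambda>\<epsilon>::real. (1 / \<epsilon>) ^ N) \<in> O[at_right 0](\<lambda>\<epsilon>. (1 / \<epsilon>) ^ M)"
proof (rule bigoI[where c = 1])
  have "\<forall>\<^sub>F \<epsilon>::real in at_right 0. 0 < \<epsilon> \<and> \<epsilon> < 1"
    unfolding eventually_at_right_field by (intro exI[of _ 1]) simp
  then show "\<forall>\<^sub>F \<epsilon>::real in at_right 0. norm ((1 / \<epsilon>) ^ N) \<le> 1 * norm ((1 / \<epsilon>) ^ M)"
    by eventually_elim (use assms in \<open>simp add: power_increasing abs_if\<close>)
qed

lemma moderate_add:
  assumes "moderate x" "moderate y" shows "moderate (\<lambda>\<epsilon>. x \<epsilon> + y \<epsilon>)"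
proof -
  obtain N M where N: "(\<lambda>\<epsilon>. norm (x \<epsilon>)) \<in> O[at_right 0](\<lambda>\<epsilon>. (1 / \<epsilon>) ^ N)"
    and M: "(\<lambda>\<epsilon>. norm (y \<epsilon>)) \<in> O[at_right 0](\<lambda>\<epsilon>. (1 / \<epsilon>) ^ M)"
    using assms by (auto simp: moderate_def)
  have "(\<lambda>\<epsilon>. norm (x \<epsilon>)) \<in> O[at_right 0](\<lambda>\<epsilon>. (1 / \<epsilon>) ^ (N + M))"
    by (rule landau_o.big_trans[OF N moderate_power_mono]) simp
  moreover have "(\<lambda>\<epsilon>. norm (y \<epsilon>)) \<in> O[at_right 0](\<lambda>\<epsilon>. (1 / \<epsilon>) ^ (N + M))"
    by (rule landau_o.big_trans[OF M moderate_power_mono]) simp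
  ultimately have "(\<lambda>\<epsilon>. norm (x \<epsilon>) + norm (y \<epsilon>)) \<in> O[at_right 0](\<lambda>\<epsilon>. (1 / \<epsilon>) ^ (N + M))"
    by (rule sum_in_bigo)
  then have "(\<lambda>\<epsilon>. norm (norm (x \<epsilon>) + norm (y \<epsilon>))) \<in> O[at_right 0](\<lambda>\<epsilon>. (1 / \<epsilon>) ^ (N + M))"
    by simp
  then have "(\<lambda>\<epsilon>. norm (x \<epsilon> + y \<epsilon>)) \<in> O[at_right 0](\<lambda>\<epsilon>. (1 / \<epsilon>) ^ (N + M))"
    by (rule bigo_norm_le[rotated]) (use norm_triangle_ineq in auto)
  then show ?thesis by (auto simp: moderate_def)
qed

lemma moderate_scaleR: "moderate x \<Longrightarrow> moderate (\<lambda>\<epsilon>. r *\<^sub>R x \<epsilon>)"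
  by (auto simp: moderate_def)

lemma moderate_mult:
  fixes x y :: "real \<Rightarrow> 'a::real_normed_field"
  assumes "moderate x" "moderate y" shows "moderate (\<lambda>\<epsilon>. x \<epsilon> * y \<epsilon>)"
proof -
  obtain N M where "(\<lambda>\<epsilon>. norm (x \<epsilon>)) \<in> O[at_right 0](\<lambda>\<epsilon>. (1 / \<epsilon>) ^ N)"
    and "(\<lambda>\<epsilon>. norm (y \<epsilon>)) \<in> O[at_right 0](\<lambda>\<epsilon>. (1 / \<epsilon>) ^ M)"
    using assms by (auto simp: moderate_def)
  then have "(\<lambda>\<epsilon>. norm (x \<epsilon>) * norm (y \<epsilon>)) \<in> O[at_right 0](\<lambda>\<epsilon>. (1 / \<epsilon>) ^ N * (1 / \<epsilon>) ^ M)"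
    by (rule landau_o.big_mult)
  then show ?thesis
    unfolding moderate_def power_add[symmetric] norm_mult by blast
qed

lemma moderate_const: "moderate (\<lambda>\<epsilon>. c)"
proof -
  have "(\<lambda>\<epsilon>. norm c) \<in> O[at_right 0](\<lambda>\<epsilon>::real. (1 / \<epsilon>) ^ 0)" by simp
  then show ?thesis unfolding moderate_def by blast
qed

lemma moderate_norm: "moderate x \<Longrightarrow> moderate (\<lambda>\<epsilon>. norm (x \<epsilon>))"
  by (simp add: moderate_def)

lemma null_net_add:
  assumes "null_net x" "null_net y" shows "null_net (\<lambda>\<epsilon>. x \<epsilon> + y \<epsilon>)"
  unfolding null_net_def
proof
  fix m :: nat
  have "(\<lambda>\<epsilon>. norm (x \<epsilon>) + norm (y \<epsilon>)) \<in> O[at_right 0](\<lambda>\<epsilon>. \<epsilon> ^ m)"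
    using assms by (intro sum_in_bigo) (auto simp: null_net_def)
  then have "(\<lambda>\<epsilon>. norm (norm (x \<epsilon>) + norm (y \<epsilon>))) \<in> O[at_right 0](\<lambda>\<epsilon>. \<epsilon> ^ m)"
    by simp
  then show "(\<lambda>\<epsilon>. norm (x \<epsilon> + y \<epsilon>)) \<in> O[at_right 0](\<lambda>\<epsilon>. \<epsilon> ^ m)"
    by (rule bigo_norm_le[rotated]) (use norm_triangle_ineq in auto)
qed

lemma null_net_scaleR: "null_net x \<Longrightarrow> null_net (\<lambda>\<epsilon>. r *\<^sub>R x \<epsilon>)"
  by (auto simp: null_net_def)

lemma null_net_zero: "null_net (\<lambda>\<epsilon>. 0)"
  by (simp add: null_net_def)

lemma null_net_mult:
  fixes x y :: "real \<Rightarrow> 'a::real_normed_field"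
  assumes "moderate x" "null_net y" shows "null_net (\<lambda>\<epsilon>. x \<epsilon> * y \<epsilon>)"
  unfolding null_net_def
proof
  fix m :: nat
  obtain N where N: "(\<lambda>\<epsilon>. norm (x \<epsilon>)) \<in> O[at_right 0](\<lambda>\<epsilon>. (1 / \<epsilon>) ^ N)"
    using assms(1) by (auto simp: moderate_def)
  have "(\<lambda>\<epsilon>. norm (y \<epsilon>)) \<in> O[at_right 0](\<lambda>\<epsilon>. \<epsilon> ^ (N + m))"
    using assms(2) by (auto simp: null_net_def)
  with N have "(\<lambda>\<epsilon>. norm (x \<epsilon>) * norm (y \<epsilon>)) \<in> O[at_right 0](\<lambda>\<epsilon>. (1 / \<epsilon>) ^ N * \<epsilon> ^ (N + m))"
    by (rule landau_o.big_mult)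
  also have "\<forall>\<^sub>F \<epsilon>::real in at_right 0. (1 / \<epsilon>) ^ N * \<epsilon> ^ (N + m) = \<epsilon> ^ m"
    using eventually_at_right_less[of "0::real"]
    by eventually_elim (simp add: power_add power_one_over)
  then have "O[at_right 0](\<lambda>\<epsilon>::real. (1 / \<epsilon>) ^ N * \<epsilon> ^ (N + m)) = O[at_right 0](\<lambda>\<epsilon>. \<epsilon> ^ m)"
    by (rule landau_o.big.cong)
  finally show "(\<lambda>\<epsilon>. norm (x \<epsilon> * y \<epsilon>)) \<in> O[at_right 0](\<lambda>\<epsilon>. \<epsilon> ^ m)"
    by (simp add: norm_mult)
qed

lemma not_null_net_one: "\<not> null_net (\<lambda>\<epsilon>. 1 :: 'a::real_normed_field)"
proof
  assume "null_net (\<lambda>\<epsilon>. 1 :: 'a)"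
  then have *: "(\<lambda>\<epsilon>::real. norm (1::'a)) \<in> O[at_right 0](\<lambda>\<epsilon>. \<epsilon> ^ 1)"
    unfolding null_net_def by blast
  then obtain c where c: "c > 0" "\<forall>\<^sub>F \<epsilon>::real in at_right 0. 1 \<le> c * \<bar>\<epsilon>\<bar>"
    by (elim landau_o.bigE) auto
  have "\<forall>\<^sub>F \<epsilon>::real in at_right 0. \<epsilon> < inverse c"
    unfolding eventually_at_right_field using c(1) by (intro exI[of _ "inverse c"]) simp
  with c(2) eventually_at_right_less[of "0::real"] have "\<forall>\<^sub>F \<epsilon>::real in at_right 0. False"
    by eventually_elim (use c(1) in \<open>auto simp: field_simps\<close>)
  then show False by simp
qed

lemma part_equivp_net_equiv: "part_equivp (net_equiv :: (real \<Rightarrow> 'a::real_normed_vector) \<Rightarrow> _)"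
proof (rule part_equivpI)
  show "\<exists>x::real \<Rightarrow> 'a. net_equiv x x"
    by (intro exI[of _ "\<lambda>_. 0"]) (simp add: net_equiv_def moderate_const null_net_zero)
  show "symp (net_equiv :: (real \<Rightarrow> 'a) \<Rightarrow> _)"
    by (auto intro!: sympI simp: net_equiv_def null_net_def norm_minus_commute)
  show "transp (net_equiv :: (real \<Rightarrow> 'a) \<Rightarrow> _)"
  proof (rule transpI)
    fix x y z :: "real \<Rightarrow> 'a"
    assume "net_equiv x y" "net_equiv y z"
    then show "net_equiv x z"
      using null_net_add[of "\<lambda>\<epsilon>. x \<epsilon> - y \<epsilon>" "\<lambda>\<epsilon>. y \<epsilon> - z \<epsilon>"] by (simp add: net_equiv_def)
  qed
qed

quotient_type (overloaded) 'a gen = "real \<Rightarrow> 'a::real_normed_vector" / partial: net_equiv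
  by (rule part_equivp_net_equiv)

instantiation gen :: (real_normed_vector) real_vector
begin

lift_definition zero_gen :: "'a gen" is "\<lambda>\<epsilon>. 0"
  by (simp add: net_equiv_def moderate_const null_net_zero)

lift_definition scaleR_gen :: "real \<Rightarrow> 'a gen \<Rightarrow> 'a gen" is "\<lambda>r x \<epsilon>. r *\<^sub>R x \<epsilon>"
  by (simp add: net_equiv_def moderate_scaleR null_net_scaleR scaleR_diff_right[symmetric])

lift_definition plus_gen :: "'a gen \<Rightarrow> 'a gen \<Rightarrow> 'a gen" is "\<lambda>x y \<epsilon>. x \<epsilon> + y \<epsilon>"
  by (simp add: net_equiv_def moderate_add null_net_add add_diff_add)

lift_definition uminus_gen :: "'a gen \<Rightarrow> 'a gen" is "\<lambda>x \<epsilon>. - x \<epsilon>"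
  by (simp add: net_equiv_def moderate_def null_net_def norm_minus_commute)

definition minus_gen :: "'a gen \<Rightarrow> 'a gen \<Rightarrow> 'a gen" where
  "minus_gen x y = x + - y"

instance
proof
  fix a b c :: "'a gen" and r s :: real
  show "a + b + c = a + (b + c)"
    by transfer (simp add: net_equiv_def moderate_add null_net_zero add.assoc)
  show "a + b = b + a"
    by transfer (simp add: net_equiv_def moderate_add null_net_zero add.commute)
  show "0 + a = a"
    by transfer (simp add: net_equiv_def null_net_zero)
  show "- a + a = 0"
    by transfer (simp add: net_equiv_def moderate_const null_net_zero)
  show "a - b = a + - b"
    by (rule minus_gen_def)
  show "r *\<^sub>R (a + b) = r *\<^sub>R a + r *\<^sub>R b"
    by transfer (simp add: net_equiv_def moderate_add moderate_scaleR null_net_zero scaleR_add_right)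
  show "(r + s) *\<^sub>R a = r *\<^sub>R a + s *\<^sub>R a"
    by transfer (simp add: net_equiv_def moderate_add moderate_scaleR null_net_zero scaleR_add_left)
  show "r *\<^sub>R s *\<^sub>R a = (r * s) *\<^sub>R a"
    by transfer (simp add: net_equiv_def moderate_scaleR null_net_zero)
  show "1 *\<^sub>R a = a"
    by transfer (simp add: net_equiv_def null_net_zero)
qed

end

instantiation gen :: (real_normed_field) comm_ring_1
begin

lift_definition one_gen :: "'a gen" is "\<lambda>\<epsilon>. 1"
  by (simp add: net_equiv_def moderate_const null_net_zero)

lift_definition times_gen :: "'a gen \<Rightarrow> 'a gen \<Rightarrow> 'a gen" is "\<lambda>x y \<epsilon>. x \<epsilon> * y \<epsilon>"
proof -
  fix x x' y y' :: "real \<Rightarrow> 'a"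
  assume "net_equiv x x'" "net_equiv y y'"
  moreover have "(\<lambda>\<epsilon>. x \<epsilon> * y \<epsilon> - x' \<epsilon> * y' \<epsilon>)
      = (\<lambda>\<epsilon>. x \<epsilon> * (y \<epsilon> - y' \<epsilon>) + y' \<epsilon> * (x \<epsilon> - x' \<epsilon>))"
    by (simp add: algebra_simps)
  ultimately show "net_equiv (\<lambda>\<epsilon>. x \<epsilon> * y \<epsilon>) (\<lambda>\<epsilon>. x' \<epsilon> * y' \<epsilon>)"
    by (auto simp: net_equiv_def moderate_mult intro!: null_net_add null_net_mult)
qed

instance
proof
  fix a b c :: "'a gen"
  show "a * b * c = a * (b * c)"
    by transfer (simp add: net_equiv_def moderate_mult null_net_zero mult.assoc)
  show "a * b = b * a"
    by transfer (simp add: net_equiv_def moderate_mult null_net_zero mult.commute)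
  show "1 * a = a"
    by transfer (simp add: net_equiv_def null_net_zero)
  show "(a + b) * c = a * c + b * c"
    by transfer (simp add: net_equiv_def moderate_add moderate_mult null_net_zero distrib_right)
  show "(0::'a gen) \<noteq> 1"
  proof transfer
    have "\<not> null_net (\<lambda>\<epsilon>. 0 - 1 :: 'a)"
      using not_null_net_one[where 'a = 'a] by (simp add: null_net_def)
    then show "\<not> net_equiv (\<lambda>\<epsilon>. 0 :: 'a) (\<lambda>\<epsilon>. 1)"
      by (simp add: net_equiv_def)
  qed
qed

end

lift_definition gabs :: "'a::real_normed_vector gen \<Rightarrow> real gen" is "\<lambda>x \<epsilon>. norm (x \<epsilon>)"
proof -
  fix x y :: "real \<Rightarrow> 'a"
  assume *: "net_equiv x y"
  have "null_net (\<lambda>\<epsilon>. norm (x \<epsilon>) - norm (y \<epsilon>))"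
    unfolding null_net_def
  proof
    fix m :: nat
    have "(\<lambda>\<epsilon>. norm (x \<epsilon> - y \<epsilon>)) \<in> O[at_right 0](\<lambda>\<epsilon>. \<epsilon> ^ m)"
      using * by (auto simp: net_equiv_def null_net_def)
    then show "(\<lambda>\<epsilon>. norm (norm (x \<epsilon>) - norm (y \<epsilon>))) \<in> O[at_right 0](\<lambda>\<epsilon>. \<epsilon> ^ m)"
      by (rule bigo_norm_le[rotated]) (simp add: norm_triangle_ineq3)
  qed
  with * show "net_equiv (\<lambda>\<epsilon>. norm (x \<epsilon>)) (\<lambda>\<epsilon>. norm (y \<epsilon>))"
    by (simp add: net_equiv_def moderate_norm)
qed

definition gle :: "real gen \<Rightarrow> real gen \<Rightarrow> bool" (infix "\<le>\<^sub>g" 50) where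
  "x \<le>\<^sub>g y \<longleftrightarrow> (\<exists>x' y'. moderate x' \<and> moderate y' \<and> x = abs_gen x' \<and> y = abs_gen y' \<and>
      (\<forall>\<^sub>F \<epsilon> in at_right 0. x' \<epsilon> \<le> y' \<epsilon>))"

text \<open>The strict relation asks for invertibility of the difference, which is more than \<open>x \<noteq> y\<close>.\<close>

definition gless :: "real gen \<Rightarrow> real gen \<Rightarrow> bool" (infix "<\<^sub>g" 50) where
  "x <\<^sub>g y \<longleftrightarrow> x \<le>\<^sub>g y \<and> (y - x) dvd 1"

text \<open>The order is only partial; the maximum of a finite set is taken on representatives and does not
  depend on them.\<close>

definition gMax :: "real gen set \<Rightarrow> real gen" where
  "gMax A = abs_gen (\<lambda>\<epsilon>. Max ((\<lambda>x. rep_gen x \<epsilon>) ` A))"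

definition sharp_topology :: "'a::real_normed_vector gen topology" where
  "sharp_topology = topology_generated_by {{y. gabs (y - x) <\<^sub>g \<rho>} | x \<rho>. 0 <\<^sub>g \<rho>}"

definition internal_set :: "(real \<Rightarrow> 'a::real_normed_vector set) \<Rightarrow> 'a gen set" where
  "internal_set A = {abs_gen x | x. moderate x \<and> (\<forall>\<^sub>F \<epsilon> in at_right 0. x \<epsilon> \<in> A \<epsilon>)}"

definition strongly_internal_set :: "(real \<Rightarrow> 'a::real_normed_vector set) \<Rightarrow> 'a gen set" where
  "strongly_internal_set A = {abs_gen x | x. moderate x \<and>
      (\<forall>y. net_equiv y x \<longrightarrow> (\<forall>\<^sub>F \<epsilon> in at_right 0. y \<epsilon> \<in> A \<epsilon>))}"

definition functionally_compact :: "'a::real_normed_vector gen set \<Rightarrow> bool" where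
  "functionally_compact K \<longleftrightarrow> (\<exists>A N. (\<forall>\<epsilon>\<in>{0<..1}. compact (A \<epsilon>)) \<and> (0::real) < N \<and>
      (\<forall>\<^sub>F \<epsilon> in at_right 0. \<forall>x\<in>A \<epsilon>. norm x \<le> \<epsilon> powr - N) \<and> K = internal_set A)"


section \<open>Smooth functions and partial derivatives\<close>

definition partial :: "'n \<Rightarrow> (real^'n \<Rightarrow> real) \<Rightarrow> real^'n \<Rightarrow> real" where
  "partial i u x = deriv (\<lambda>t. u (x + t *\<^sub>R axis i 1)) 0"

text \<open>For open \<open>S\<close> this is \<open>C\<^sup>\<infinity>(S)\<close>: all iterated partial derivatives exist and are differentiable,
  hence continuous.\<close>

definition smooth_on :: "(real^'n::finite) set \<Rightarrow> (real^'n \<Rightarrow> real) \<Rightarrow> bool" where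
  "smooth_on S u \<longleftrightarrow> (\<forall>is. \<forall>x\<in>S. foldr partial is u differentiable (at x))"

text \<open>A multi-index is a function \<open>\<alpha> :: 'n \<Rightarrow> nat\<close> of length \<open>sum \<alpha> UNIV\<close>. The partial derivatives are
  taken in the order of a fixed enumeration of the coordinates, which is immaterial for smooth
  functions.\<close>

definition coords :: "'n::finite list" where
  "coords = (SOME is. distinct is \<and> set is = UNIV)"

definition mderiv :: "('n \<Rightarrow> nat) \<Rightarrow> (real^'n::finite \<Rightarrow> real) \<Rightarrow> real^'n \<Rightarrow> real" where
  "mderiv \<alpha> u = foldr partial (concat (map (\<lambda>i. replicate (\<alpha> i) i) coords)) u"


section \<open>Generalized smooth functions\<close>

text \<open>A scalar function on a set \<open>X\<close> of generalized points is represented by its extension by \<open>0\<close>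
  outside \<open>X\<close>, so that the vector space operations are the pointwise ones.\<close>

definition gsf_of :: "(real^'n::finite) gen set \<Rightarrow> (real \<Rightarrow> real^'n \<Rightarrow> real) \<Rightarrow> (real^'n) gen \<Rightarrow> real gen"
  where "gsf_of X u = (\<lambda>x. if x \<in> X then abs_gen (\<lambda>\<epsilon>. u \<epsilon> (rep_gen x \<epsilon>)) else 0)"

definition gsf_restrict :: "(real^'n::finite) gen set \<Rightarrow> ((real^'n) gen \<Rightarrow> real gen) \<Rightarrow> (real^'n) gen \<Rightarrow> real gen"
  where "gsf_restrict X f = (\<lambda>x. if x \<in> X then f x else 0)"

definition defines_gsf :: "(real \<Rightarrow> (real^'n::finite) set) \<Rightarrow> (real \<Rightarrow> real^'n \<Rightarrow> real) \<Rightarrow>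
    (real^'n) gen set \<Rightarrow> ((real^'n) gen \<Rightarrow> real gen) \<Rightarrow> bool" where
  "defines_gsf \<Omega> u X f \<longleftrightarrow>
     (\<forall>\<epsilon>\<in>{0<..1}. open (\<Omega> \<epsilon>) \<and> smooth_on (\<Omega> \<epsilon>) (u \<epsilon>)) \<and>
     X \<subseteq> strongly_internal_set \<Omega> \<and>
     (\<forall>x. moderate x \<and> abs_gen x \<in> X \<longrightarrow>
        (\<forall>\<alpha>. moderate (\<lambda>\<epsilon>. mderiv \<alpha> (u \<epsilon>) (x \<epsilon>))) \<and>
        f (abs_gen x) = abs_gen (\<lambda>\<epsilon>. u \<epsilon> (x \<epsilon>)))"

definition gsf :: "(real^'n::finite) gen set \<Rightarrow> ((real^'n) gen \<Rightarrow> real gen) set" where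
  "gsf X = {f. (\<forall>x. x \<notin> X \<longrightarrow> f x = 0) \<and> (\<exists>\<Omega> u. defines_gsf \<Omega> u X f)}"

text \<open>For sharply open \<open>U\<close> and \<open>f \<in> gsf U\<close> the value below does not depend on the defining net or
  on the representative of the point.\<close>

definition gderiv :: "(real^'n::finite) gen set \<Rightarrow> ('n \<Rightarrow> nat) \<Rightarrow> ((real^'n) gen \<Rightarrow> real gen) \<Rightarrow>
    (real^'n) gen \<Rightarrow> real gen" where
  "gderiv U \<alpha> f p = (THE y. \<exists>\<Omega> u x. defines_gsf \<Omega> u U f \<and> moderate x \<and> abs_gen x = p \<and>
      y = abs_gen (\<lambda>\<epsilon>. mderiv \<alpha> (u \<epsilon>) (x \<epsilon>)))"


section \<open>Compactly supported generalized smooth functions\<close>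

definition ext_set :: "'a::real_normed_vector gen set \<Rightarrow> 'a gen set" where
  "ext_set K = {x. \<forall>a\<in>K. 0 <\<^sub>g gabs (x - a)}"

definition GD :: "(real^'n::finite) gen set \<Rightarrow> (real^'n) gen set \<Rightarrow> ((real^'n) gen \<Rightarrow> real gen) set" where
  "GD K U = {f \<in> gsf U. \<exists>u. defines_gsf (\<lambda>_. UNIV) u U f \<and>
      (\<forall>\<alpha> x. moderate x \<and> abs_gen x \<in> ext_set K \<longrightarrow> null_net (\<lambda>\<epsilon>. mderiv \<alpha> (u \<epsilon>) (x \<epsilon>)))}"

text \<open>Extremal points of the derivatives exist for \<open>f \<in> GD K U\<close>, and \<open>GD_norm\<close> depends neither on
  their choice nor on \<open>K\<close>.\<close>

definition max_point :: "'a set \<Rightarrow> ('a \<Rightarrow> real gen) \<Rightarrow> 'a" where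
  "max_point K h = (SOME p. p \<in> K \<and> (\<forall>x\<in>K. h x \<le>\<^sub>g h p))"

definition min_point :: "'a set \<Rightarrow> ('a \<Rightarrow> real gen) \<Rightarrow> 'a" where
  "min_point K h = (SOME p. p \<in> K \<and> (\<forall>x\<in>K. h p \<le>\<^sub>g h x))"

definition GD_norm :: "(real^'n::finite) gen set \<Rightarrow> (real^'n) gen set \<Rightarrow> nat \<Rightarrow>
    ((real^'n) gen \<Rightarrow> real gen) \<Rightarrow> real gen" where
  "GD_norm K U m f = gMax (\<Union>\<alpha>\<in>{\<alpha>. sum \<alpha> UNIV \<le> m}.
      {gabs (gderiv U \<alpha> f (max_point K (gderiv U \<alpha> f))),
       gabs (gderiv U \<alpha> f (min_point K (gderiv U \<alpha> f)))})"

definition GD_ball :: "(real^'n::finite) gen set \<Rightarrow> (real^'n) gen set \<Rightarrow> nat \<Rightarrow> real gen \<Rightarrow>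
    ((real^'n) gen \<Rightarrow> real gen) set" where
  "GD_ball K U m \<rho> = {g \<in> GD K U. GD_norm K U m g <\<^sub>g \<rho>}"


section \<open>The special Colombeau algebra\<close>

definition compactly_supported_points :: "(real^'n::finite) set \<Rightarrow> (real^'n) gen set" where
  "compactly_supported_points \<Omega> = (\<Union>C\<in>{C. compact C \<and> C \<subseteq> \<Omega>}. internal_set (\<lambda>_. C))"

definition colombeau_moderate :: "(real^'n::finite) set \<Rightarrow> (real \<Rightarrow> real^'n \<Rightarrow> real) set" where
  "colombeau_moderate \<Omega> = {u. (\<forall>\<epsilon>\<in>{0<..1}. smooth_on \<Omega> (u \<epsilon>)) \<and>
      (\<forall>C \<alpha>. compact C \<and> C \<subseteq> \<Omega> \<longrightarrow> (\<exists>(N::nat) c. \<forall>\<^sub>F \<epsilon> in at_right 0.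
          \<forall>x\<in>C. \<bar>mderiv \<alpha> (u \<epsilon>) x\<bar> \<le> c * (1 / \<epsilon>) ^ N))}"

definition colombeau_equiv ::
  "(real^'n::finite) set \<Rightarrow> ((real \<Rightarrow> real^'n \<Rightarrow> real) \<times> (real \<Rightarrow> real^'n \<Rightarrow> real)) set" where
  "colombeau_equiv \<Omega> = {(u, v). u \<in> colombeau_moderate \<Omega> \<and> v \<in> colombeau_moderate \<Omega> \<and>
      (\<forall>C \<alpha>. compact C \<and> C \<subseteq> \<Omega> \<longrightarrow> (\<forall>m::nat. \<exists>c. \<forall>\<^sub>F \<epsilon> in at_right 0.
          \<forall>x\<in>C. \<bar>mderiv \<alpha> (\<lambda>y. u \<epsilon> y - v \<epsilon> y) x\<bar> \<le> c * \<epsilon> ^ m))}"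

text \<open>The quotient algebra, with each class identified with the function it induces on compactly
  supported generalized points.\<close>

definition colombeau_algebra :: "(real^'n::finite) set \<Rightarrow> ((real^'n) gen \<Rightarrow> real gen) set" where
  "colombeau_algebra \<Omega> = (\<lambda>c. gsf_of (compactly_supported_points \<Omega>) (SOME u. u \<in> c)) `
      (colombeau_moderate \<Omega> // colombeau_equiv \<Omega>)"

text \<open>An element of the algebra lies in the ball if one of its extensions to a compactly supported
  function on all generalized points does.\<close>

definition colombeau_ball :: "(real^'n::finite) set \<Rightarrow> (real^'n) gen set \<Rightarrow> nat \<Rightarrow> real gen \<Rightarrow>
    ((real^'n) gen \<Rightarrow> real gen) set" where
  "colombeau_ball \<Omega> K m \<rho> =
     {f \<in> colombeau_algebra \<Omega>. \<exists>g\<in>GD_ball K UNIV m \<rho>. gsf_restrict (compactly_supported_points \<Omega>) g = f}"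


section \<open>The Dirac delta\<close>

definition monomial :: "('n \<Rightarrow> nat) \<Rightarrow> real^'n::finite \<Rightarrow> real" where
  "monomial \<alpha> x = (\<Prod>i\<in>UNIV. (x $ i) ^ \<alpha> i)"

definition schwartz :: "(real^'n::finite \<Rightarrow> real) \<Rightarrow> bool" where
  "schwartz \<mu> \<longleftrightarrow> smooth_on UNIV \<mu> \<and> (\<forall>\<alpha> \<beta>. bounded (range (\<lambda>x. monomial \<beta> x * mderiv \<alpha> \<mu> x)))"

definition colombeau_mollifier :: "(real^'n::finite \<Rightarrow> real) \<Rightarrow> bool" where
  "colombeau_mollifier \<mu> \<longleftrightarrow> schwartz \<mu> \<and> (LINT x|lborel. \<mu> x) = 1 \<and>
     (\<forall>\<alpha>. 1 \<le> sum \<alpha> UNIV \<longrightarrow> (LINT x|lborel. monomial \<alpha> x * \<mu> x) = 0)"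

text \<open>The other customary choice: no single compactly supported function has all higher moments zero,
  so the mollifier is made to depend on \<open>\<epsilon>\<close>.\<close>

definition compact_mollifier_net :: "(real \<Rightarrow> real^'n::finite \<Rightarrow> real) \<Rightarrow> bool" where
  "compact_mollifier_net \<psi> \<longleftrightarrow>
     (\<forall>\<epsilon>\<in>{0<..1}. smooth_on UNIV (\<psi> \<epsilon>) \<and> (\<forall>x. norm x > 1 \<longrightarrow> \<psi> \<epsilon> x = 0) \<and>
        (LINT x|lborel. \<psi> \<epsilon> x) = 1) \<and>
     (\<forall>\<alpha>. \<exists>(N::nat) c. \<forall>\<^sub>F \<epsilon> in at_right 0. \<forall>x. \<bar>mderiv \<alpha> (\<psi> \<epsilon>) x\<bar> \<le> c * (1 / \<epsilon>) ^ N) \<and>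
     (\<forall>j. \<forall>\<^sub>F \<epsilon> in at_right 0. \<forall>\<alpha>. 1 \<le> sum \<alpha> UNIV \<and> sum \<alpha> UNIV \<le> j \<longrightarrow>
        (LINT x|lborel. monomial \<alpha> x * \<psi> \<epsilon> x) = 0) \<and>
     (\<forall>\<eta>>0. \<forall>\<^sub>F \<epsilon> in at_right 0. (LINT x|lborel. \<bar>\<psi> \<epsilon> x\<bar>) \<le> 1 + \<eta>)"

text \<open>\<open>b\<close> is the scale of the embedding; the classical choice is \<open>b = (\<lambda>\<epsilon>. 1 / \<epsilon>)\<close>.\<close>

definition embedding_mollifier :: "(real \<Rightarrow> real^'n::finite \<Rightarrow> real) \<Rightarrow> (real \<Rightarrow> real) \<Rightarrow> bool" where
  "embedding_mollifier \<psi> b \<longleftrightarrow>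
     ((\<exists>\<mu>. colombeau_mollifier \<mu> \<and> \<psi> = (\<lambda>_. \<mu>)) \<or> compact_mollifier_net \<psi>) \<and>
     moderate b \<and> (\<exists>a>0. \<forall>\<^sub>F \<epsilon> in at_right 0. \<epsilon> powr - a \<le> b \<epsilon>)"

text \<open>Convolution of the compactly supported distribution \<open>T\<close> with the scaled mollifiers
  \<open>x \<mapsto> b\<^sub>\<epsilon>\<^sup>n \<psi>\<^sub>\<epsilon>(b\<^sub>\<epsilon> x)\<close>.\<close>

definition mollify :: "(real \<Rightarrow> real^'n::finite \<Rightarrow> real) \<Rightarrow> (real \<Rightarrow> real) \<Rightarrow>
    ((real^'n \<Rightarrow> real) \<Rightarrow> real) \<Rightarrow> real \<Rightarrow> real^'n \<Rightarrow> real" where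
  "mollify \<psi> b T \<epsilon> x = T (\<lambda>y. b \<epsilon> ^ CARD('n) * \<psi> \<epsilon> (b \<epsilon> *\<^sub>R (x - y)))"

text \<open>On a sharply open \<open>U\<close> the restriction \<open>dirac \<psi> b U\<close> may lose the delta: if \<open>U\<close> is a small ball
  around a nonzero real point, it is the zero function. Functions in \<open>GD K U\<close> extend uniquely by zero
  to functions in \<open>GD K UNIV\<close>, and an element of \<open>GD K U\<close> is the delta if this extension is
  \<open>dirac \<psi> b UNIV\<close>; that is, \<open>dirac \<psi> b UNIV \<in> GD K UNIV\<close> and the element is \<open>dirac \<psi> b U\<close>. For
  \<open>U = UNIV\<close> this is no extra condition. In the Colombeau algebra on \<open>\<Omega>\<close>, \<open>0 \<in> \<Omega>\<close> plays the same
  role.\<close>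

definition dirac :: "(real \<Rightarrow> real^'n::finite \<Rightarrow> real) \<Rightarrow> (real \<Rightarrow> real) \<Rightarrow> (real^'n) gen set \<Rightarrow>
    (real^'n) gen \<Rightarrow> real gen" where
  "dirac \<psi> b X = gsf_of X (mollify \<psi> b (\<lambda>\<phi>. \<phi> 0))"


section \<open>Real Hausdorff topological vector spaces\<close>

instantiation "fun" :: (type, real_vector) real_vector
begin

definition scaleR_fun :: "real \<Rightarrow> ('a \<Rightarrow> 'b) \<Rightarrow> 'a \<Rightarrow> 'b" where
  "scaleR_fun r f = (\<lambda>x. r *\<^sub>R f x)"

instance
  by standard (simp_all add: scaleR_fun_def fun_eq_iff scaleR_add_right scaleR_add_left)

end

definition hausdorff_tvs :: "'v::real_vector topology \<Rightarrow> bool" where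
  "hausdorff_tvs \<sigma> \<longleftrightarrow> subspace (topspace \<sigma>) \<and> Hausdorff_space \<sigma> \<and>
     continuous_map (prod_topology \<sigma> \<sigma>) \<sigma> (\<lambda>(f, g). f + g) \<and>
     continuous_map (prod_topology euclideanreal \<sigma>) \<sigma> (\<lambda>(r, f). r *\<^sub>R f)"

end

theory Submission
  imports Defs
begin

text \<open>If \<open>G\<close> were such a space, then continuity of \<open>r \<mapsto> r\<delta>\<close> at \<open>0\<close> and \<open>0 \<in> B\<^sup>m\<^sub>\<rho>(0)\<close> would give a
  real \<open>r > 0\<close> with \<open>r\<delta> \<in> B\<^sup>m\<^sub>\<rho>(0)\<close>, so that \<open>\<bar>r\<delta>\<bar> < 1\<close> on \<open>K\<close>. But the mollifiers take values of
  absolute value at least some fixed \<open>c > 0\<close> at points \<open>y\<^sub>\<epsilon>\<close> that stay bounded, so \<open>\<delta>\<close> is infinite at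
  \<open>[y\<^sub>\<epsilon> / b\<^sub>\<epsilon>]\<close>. This point lies in \<open>K\<close>, because \<open>\<delta>\<close> vanishes on the exterior of its support. The
  point \<open>0\<close> itself would not do, as the mollifier may vanish there.\<close>

section \<open>Nets and generalized points\<close>

text \<open>That \<open>0\<close> lies in the ball is less immediate than it looks.
  \<open>gderiv\<close> is a definite description over all defining nets, so the norm of the zero
  function is under control only after every net defining that function has been shown to have
  negligible derivatives on \<open>U\<close>. This is where sharp openness of \<open>U\<close>
  enters: a derivative is estimated from values at neighbouring points, which must again belong to
  \<open>U\<close>. The opposite estimate works at order zero: a bound on the norm bounds the
  function on \<open>K\<close> by a real constant, and a fixed real factor r > 0 cannot make an
  infinite value finite. In the Colombeau algebra the ball is defined through extensions whose
  values elsewhere are unknown, so the contradiction is drawn from a single point that lies both in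
  \<open>K\<close> and among the compactly supported points.\<close>

lemma eventually_small:
  assumes "c > 0"
  shows "\<forall>\<^sub>F \<epsilon>::real in at_right 0. 0 < \<epsilon> \<and> \<epsilon> < c"
  using assms unfolding eventually_at_right_field by blast

text \<open>Since all exponents are quantified over, one spare power of \<epsilon> absorbs the
  Landau constant. In \<open>moderate_iff\<close> the same is achieved by raising the exponent by
  one.\<close>

lemma null_net_iff: "null_net x \<longleftrightarrow> (\<forall>m. \<forall>\<^sub>F \<epsilon> in at_right 0. norm (x \<epsilon>) \<le> \<epsilon> ^ m)"
proof
  assume x: "null_net x"
  show "\<forall>m. \<forall>\<^sub>F \<epsilon> in at_right 0. norm (x \<epsilon>) \<le> \<epsilon> ^ m"
  proof
    fix m
    have "(\<lambda>\<epsilon>. norm (x \<epsilon>)) \<in> O[at_right 0](\<lambda>\<epsilon>. \<epsilon> ^ Suc m)"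
      using x unfolding null_net_def by blast
    then obtain c where c: "c > 0" "\<forall>\<^sub>F \<epsilon> in at_right 0. norm (norm (x \<epsilon>)) \<le> c * norm (\<epsilon> ^ Suc m)"
      by (elim landau_o.bigE)
    have "1 / c > 0" using c by simp
    from c(2) eventually_small[OF this] show "\<forall>\<^sub>F \<epsilon> in at_right 0. norm (x \<epsilon>) \<le> \<epsilon> ^ m"
    proof eventually_elim
      case (elim \<epsilon>)
      then have "norm (x \<epsilon>) \<le> (c * \<epsilon>) * \<epsilon> ^ m"
        by (simp add: mult.assoc)
      also have "\<dots> \<le> 1 * \<epsilon> ^ m"
        using c elim by (intro mult_right_mono) (auto simp: field_simps)
      finally show ?case by simp
    qed
  qed
next
  assume x: "\<forall>m. \<forall>\<^sub>F \<epsilon> in at_right 0. norm (x \<epsilon>) \<le> \<epsilon> ^ m"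
  show "null_net x"
    unfolding null_net_def
  proof
    fix m
    show "(\<lambda>\<epsilon>. norm (x \<epsilon>)) \<in> O[at_right 0](\<lambda>\<epsilon>. \<epsilon> ^ m)"
    proof (rule bigoI[where c = 1])
      show "\<forall>\<^sub>F \<epsilon> in at_right 0. norm (norm (x \<epsilon>)) \<le> 1 * norm (\<epsilon> ^ m)"
        using x[rule_format, of m] eventually_small[OF zero_less_one] by eventually_elim simp
    qed
  qed
qed

lemma moderate_iff: "moderate x \<longleftrightarrow> (\<exists>N. \<forall>\<^sub>F \<epsilon> in at_right 0. norm (x \<epsilon>) \<le> (1 / \<epsilon>) ^ N)"
proof
  assume "moderate x"
  then obtain N where "(\<lambda>\<epsilon>. norm (x \<epsilon>)) \<in> O[at_right 0](\<lambda>\<epsilon>. (1 / \<epsilon>) ^ N)"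
    unfolding moderate_def by blast
  then obtain c where c: "c > 0" "\<forall>\<^sub>F \<epsilon> in at_right 0. norm (norm (x \<epsilon>)) \<le> c * norm ((1 / \<epsilon>) ^ N)"
    by (elim landau_o.bigE)
  have "1 / c > 0" using c by simp
  from c(2) eventually_small[OF this]
  have "\<forall>\<^sub>F \<epsilon> in at_right 0. norm (x \<epsilon>) \<le> (1 / \<epsilon>) ^ Suc N"
  proof eventually_elim
    case (elim \<epsilon>)
    then have "c * (1 / \<epsilon>) ^ N \<le> (1 / \<epsilon>) * (1 / \<epsilon>) ^ N"
      using c by (intro mult_right_mono) (auto simp: field_simps)
    with elim show ?case by (simp add: abs_mult)
  qed
  then show "\<exists>N. \<forall>\<^sub>F \<epsilon> in at_right 0. norm (x \<epsilon>) \<le> (1 / \<epsilon>) ^ N" by blast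
next
  assume "\<exists>N. \<forall>\<^sub>F \<epsilon> in at_right 0. norm (x \<epsilon>) \<le> (1 / \<epsilon>) ^ N"
  then obtain N where N: "\<forall>\<^sub>F \<epsilon> in at_right 0. norm (x \<epsilon>) \<le> (1 / \<epsilon>) ^ N" by blast
  have "(\<lambda>\<epsilon>. norm (x \<epsilon>)) \<in> O[at_right 0](\<lambda>\<epsilon>. (1 / \<epsilon>) ^ N)"
  proof (rule bigoI[where c = 1])
    show "\<forall>\<^sub>F \<epsilon> in at_right 0. norm (norm (x \<epsilon>)) \<le> 1 * norm ((1 / \<epsilon>) ^ N)"
      using N eventually_small[OF zero_less_one] by eventually_elim simp
  qed
  then show "moderate x" unfolding moderate_def by blast
qed

lemma moderate_bound:
  assumes "moderate y" "\<forall>\<^sub>F \<epsilon> in at_right 0. norm (x \<epsilon>) \<le> norm (y \<epsilon>)"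
  shows "moderate x"
proof -
  obtain N where "\<forall>\<^sub>F \<epsilon> in at_right 0. norm (y \<epsilon>) \<le> (1 / \<epsilon>) ^ N"
    using assms(1) moderate_iff by blast
  with assms(2) have "\<forall>\<^sub>F \<epsilon> in at_right 0. norm (x \<epsilon>) \<le> (1 / \<epsilon>) ^ N"
    by eventually_elim simp
  then show ?thesis unfolding moderate_iff by blast
qed

lemma null_net_bound:
  assumes "null_net y" "\<forall>\<^sub>F \<epsilon> in at_right 0. norm (x \<epsilon>) \<le> norm (y \<epsilon>)"
  shows "null_net x"
  unfolding null_net_iff
proof
  fix m
  have "\<forall>\<^sub>F \<epsilon> in at_right 0. norm (y \<epsilon>) \<le> \<epsilon> ^ m"
    using assms(1) null_net_iff by blast
  with assms(2) show "\<forall>\<^sub>F \<epsilon> in at_right 0. norm (x \<epsilon>) \<le> \<epsilon> ^ m"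
    by eventually_elim simp
qed

lemma moderate_powr: "moderate (\<lambda>\<epsilon>::real. \<epsilon> powr - a)"
proof -
  obtain N :: nat where N: "a \<le> real N" using real_arch_simple by blast
  have "\<forall>\<^sub>F \<epsilon>::real in at_right 0. norm (\<epsilon> powr - a) \<le> (1 / \<epsilon>) ^ N"
    using eventually_small[OF zero_less_one]
  proof eventually_elim
    case (elim \<epsilon>)
    have "\<epsilon> powr - a \<le> \<epsilon> powr - real N"
      using elim N by (intro powr_mono') auto
    also have "\<dots> = (1 / \<epsilon>) ^ N"
      using elim by (simp add: powr_minus powr_realpow power_one_over inverse_eq_divide)
    finally show ?case by simp
  qed
  then show ?thesis unfolding moderate_iff by blast
qed

lemma moderate_inverse_power: "moderate (\<lambda>\<epsilon>::real. (1 / \<epsilon>) ^ N)"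
  unfolding moderate_iff
  by (rule exI[of _ N], use eventually_small[OF zero_less_one] in eventually_elim) simp

lemma moderate_diff:
  assumes "moderate x" "moderate y" shows "moderate (\<lambda>\<epsilon>. x \<epsilon> - y \<epsilon>)"
  using moderate_add[of x "\<lambda>\<epsilon>. - y \<epsilon>"] assms by (simp add: moderate_def)

lemma null_net_diff_commute: "null_net (\<lambda>\<epsilon>. x \<epsilon> - y \<epsilon>) \<longleftrightarrow> null_net (\<lambda>\<epsilon>. y \<epsilon> - x \<epsilon>)"
  by (simp add: null_net_def norm_minus_commute)

lemma moderate_cong_null:
  assumes "moderate x" "null_net (\<lambda>\<epsilon>. y \<epsilon> - x \<epsilon>)" shows "moderate y"
proof -
  have "\<forall>\<^sub>F \<epsilon> in at_right 0. norm (y \<epsilon> - x \<epsilon>) \<le> \<epsilon> ^ 0"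
    using assms(2)[unfolded null_net_iff] by (rule spec)
  then have "moderate (\<lambda>\<epsilon>. y \<epsilon> - x \<epsilon>)"
    unfolding moderate_iff by (intro exI[of _ 0]) simp
  from moderate_add[OF assms(1) this] show ?thesis by simp
qed

section \<open>Classes and order relations read on representatives\<close>

lemma abs_gen_eq_iff:
  assumes "moderate x" "moderate y"
  shows "abs_gen x = abs_gen y \<longleftrightarrow> null_net (\<lambda>\<epsilon>. x \<epsilon> - y \<epsilon>)"
  using Quotient_rel[OF Quotient_gen, of x y] assms
  by (simp add: net_equiv_def null_net_zero)

lemma abs_gen_rep_gen [simp]: "abs_gen (rep_gen p) = p"
  by (rule Quotient_abs_rep[OF Quotient_gen])

lemma moderate_rep_gen: "moderate (rep_gen p)"
  using Quotient_rep_reflp[OF Quotient_gen, of p] by (simp add: net_equiv_def)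

lemma null_net_rep_gen:
  assumes "moderate x" shows "null_net (\<lambda>\<epsilon>. rep_gen (abs_gen x) \<epsilon> - x \<epsilon>)"
  using abs_gen_eq_iff[OF moderate_rep_gen assms, of "abs_gen x"] by simp

lemma net_equiv_self: "moderate x \<Longrightarrow> net_equiv x x"
  by (simp add: net_equiv_def null_net_zero)

lemma abs_gen_diff:
  assumes "moderate x" "moderate y"
  shows "abs_gen x - abs_gen y = abs_gen (\<lambda>\<epsilon>. x \<epsilon> - y \<epsilon>)"
proof -
  have "moderate (\<lambda>\<epsilon>. - y \<epsilon>)" using assms(2) by (simp add: moderate_def)
  then show ?thesis
    using assms by (simp add: minus_gen_def uminus_gen.abs_eq plus_gen.abs_eq net_equiv_self)
qed

lemma gabs_abs_gen: "moderate x \<Longrightarrow> gabs (abs_gen x) = abs_gen (\<lambda>\<epsilon>. norm (x \<epsilon>))"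
  by (rule gabs.abs_eq) (rule net_equiv_self)

lemma scaleR_abs_gen: "moderate x \<Longrightarrow> r *\<^sub>R abs_gen x = abs_gen (\<lambda>\<epsilon>. r *\<^sub>R x \<epsilon>)"
  by (rule scaleR_gen.abs_eq) (rule net_equiv_self)

text \<open>The relation speaks of some pair of representatives. Passing to a given pair costs a
  null net on each side, so the pointwise inequality survives only up to an arbitrary power of
  \<epsilon>.\<close>

lemma gle_abs_genD:
  assumes "abs_gen x \<le>\<^sub>g abs_gen y" "moderate x" "moderate y"
  shows "\<forall>\<^sub>F \<epsilon> in at_right 0. x \<epsilon> \<le> y \<epsilon> + \<epsilon> ^ m"
proof -
  obtain x' y' where *: "moderate x'" "moderate y'" "abs_gen x = abs_gen x'" "abs_gen y = abs_gen y'"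
      "\<forall>\<^sub>F \<epsilon> in at_right 0. x' \<epsilon> \<le> y' \<epsilon>"
    using assms(1) unfolding gle_def by blast
  have "null_net (\<lambda>\<epsilon>. x \<epsilon> - x' \<epsilon>)" "null_net (\<lambda>\<epsilon>. y \<epsilon> - y' \<epsilon>)"
    using * assms abs_gen_eq_iff by blast+
  then have "\<forall>\<^sub>F \<epsilon> in at_right 0. norm (x \<epsilon> - x' \<epsilon>) \<le> \<epsilon> ^ Suc m"
      "\<forall>\<^sub>F \<epsilon> in at_right 0. norm (y \<epsilon> - y' \<epsilon>) \<le> \<epsilon> ^ Suc m"
    unfolding null_net_iff by blast+
  \<comment> \<open>Below 1/2, two errors of size \<open>\<epsilon> ^ Suc m\<close> add up to at
    most \<open>\<epsilon> ^ m\<close>.\<close>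
  moreover have "\<forall>\<^sub>F \<epsilon>::real in at_right 0. 0 < \<epsilon> \<and> \<epsilon> < 1/2"
    by (rule eventually_small) simp
  ultimately show ?thesis
    using *(5)
  proof eventually_elim
    case (elim \<epsilon>)
    have "\<epsilon> * \<epsilon> ^ m \<le> 1/2 * \<epsilon> ^ m"
      using elim by (intro mult_right_mono) auto
    with elim show ?case unfolding power_Suc real_norm_def by linarith
  qed
qed

lemma gle_abs_genI:
  assumes "moderate x" "moderate y" "\<forall>\<^sub>F \<epsilon> in at_right 0. x \<epsilon> \<le> y \<epsilon>"
  shows "abs_gen x \<le>\<^sub>g abs_gen y"
  using assms unfolding gle_def by blast

text \<open>The inverse is moderate, hence at most \<open>(1 / \<epsilon>) ^ N\<close>, and its
  product with \<open>z\<close> stays near 1, so \<open>z\<close> cannot become smaller than a power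
  of \<epsilon>. The exponent \<open>Suc N\<close> comes from the crude bound
  \<open>\<epsilon> \<le> \<bar>z \<epsilon> * v \<epsilon>\<bar>\<close>.\<close>

lemma abs_gen_dvd_oneD:
  fixes z :: "real \<Rightarrow> real"
  assumes "abs_gen z dvd 1" "moderate z"
  shows "\<exists>q. \<forall>\<^sub>F \<epsilon> in at_right 0. \<epsilon> ^ q \<le> \<bar>z \<epsilon>\<bar>"
proof -
  obtain w where "1 = abs_gen z * w" using assms(1) by (elim dvdE)
  moreover define v where "v = rep_gen w"
  moreover have v: "moderate v" by (simp add: v_def moderate_rep_gen)
  ultimately have "abs_gen (\<lambda>\<epsilon>. 1) = abs_gen (\<lambda>\<epsilon>. z \<epsilon> * v \<epsilon>)"
    using assms(2) times_gen.abs_eq[OF net_equiv_self net_equiv_self, of z v]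
    by (simp add: one_gen_def v_def)
  then have "null_net (\<lambda>\<epsilon>. 1 - z \<epsilon> * v \<epsilon>)"
    using abs_gen_eq_iff moderate_const moderate_mult[OF assms(2) v] by blast
  then have "\<forall>\<^sub>F \<epsilon> in at_right 0. norm (1 - z \<epsilon> * v \<epsilon>) \<le> \<epsilon> ^ 1"
    unfolding null_net_iff by blast
  moreover obtain N where "\<forall>\<^sub>F \<epsilon> in at_right 0. norm (v \<epsilon>) \<le> (1 / \<epsilon>) ^ N"
    using v unfolding moderate_iff by blast
  moreover have "\<forall>\<^sub>F \<epsilon>::real in at_right 0. 0 < \<epsilon> \<and> \<epsilon> < 1/2"
    by (rule eventually_small) simp
  ultimately have "\<forall>\<^sub>F \<epsilon> in at_right 0. \<epsilon> ^ Suc N \<le> \<bar>z \<epsilon>\<bar>"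
  proof eventually_elim
    case (elim \<epsilon>)
    then have "\<epsilon> \<le> \<bar>z \<epsilon> * v \<epsilon>\<bar>" unfolding real_norm_def power_one_right by linarith
    also have "\<dots> \<le> \<bar>z \<epsilon>\<bar> * (1 / \<epsilon>) ^ N"
      using elim by (simp add: abs_mult mult_left_mono)
    finally show ?case using elim by (simp add: field_simps)
  qed
  then show ?thesis by blast
qed

text \<open>Invertibility keeps the difference away from 0 by some \<open>\<epsilon> ^ q\<close>,
  and the order, which holds up to \<open>\<epsilon> ^ Suc q\<close>, then fixes its sign.
  Conversely, such a bound makes the pointwise reciprocal moderate.\<close>

lemma gless_abs_gen_iff:
  assumes "moderate x" "moderate y"
  shows "abs_gen x <\<^sub>g abs_gen y \<longleftrightarrow> (\<exists>q. \<forall>\<^sub>F \<epsilon> in at_right 0. \<epsilon> ^ q \<le> y \<epsilon> - x \<epsilon>)"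
proof
  assume *: "abs_gen x <\<^sub>g abs_gen y"
  have "abs_gen (\<lambda>\<epsilon>. y \<epsilon> - x \<epsilon>) dvd 1"
    using * assms by (simp add: gless_def abs_gen_diff)
  then obtain q where "\<forall>\<^sub>F \<epsilon> in at_right 0. \<epsilon> ^ q \<le> \<bar>y \<epsilon> - x \<epsilon>\<bar>"
    using abs_gen_dvd_oneD moderate_diff[OF assms(2,1)] by blast
  moreover have "\<forall>\<^sub>F \<epsilon> in at_right 0. x \<epsilon> \<le> y \<epsilon> + \<epsilon> ^ Suc q"
    using gle_abs_genD * assms unfolding gless_def by blast
  ultimately have "\<forall>\<^sub>F \<epsilon> in at_right 0. \<epsilon> ^ q \<le> y \<epsilon> - x \<epsilon>"
    using eventually_small[OF zero_less_one]
  proof eventually_elim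
    case (elim \<epsilon>)
    then have "\<epsilon> ^ Suc q < \<epsilon> ^ q" by simp
    with elim show ?case by linarith
  qed
  then show "\<exists>q. \<forall>\<^sub>F \<epsilon> in at_right 0. \<epsilon> ^ q \<le> y \<epsilon> - x \<epsilon>" by blast
next
  assume "\<exists>q. \<forall>\<^sub>F \<epsilon> in at_right 0. \<epsilon> ^ q \<le> y \<epsilon> - x \<epsilon>"
  then obtain q where "\<forall>\<^sub>F \<epsilon> in at_right 0. \<epsilon> ^ q \<le> y \<epsilon> - x \<epsilon>" by blast
  then have q: "\<forall>\<^sub>F \<epsilon> in at_right 0. 0 < \<epsilon> \<and> \<epsilon> ^ q \<le> y \<epsilon> - x \<epsilon>"
    using eventually_small[OF zero_less_one] by eventually_elim simp
  have "\<forall>\<^sub>F \<epsilon> in at_right 0. x \<epsilon> \<le> y \<epsilon>"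
    using q by eventually_elim (smt (verit) zero_less_power)
  then have le: "abs_gen x \<le>\<^sub>g abs_gen y" by (intro gle_abs_genI assms)
  define w where "w \<epsilon> = inverse (y \<epsilon> - x \<epsilon>)" for \<epsilon>
  have "\<forall>\<^sub>F \<epsilon> in at_right 0. norm (w \<epsilon>) \<le> norm ((1 / \<epsilon>) ^ q)"
    using q
  proof eventually_elim
    case (elim \<epsilon>)
    then have "\<epsilon> ^ q > 0" by simp
    with elim have "y \<epsilon> - x \<epsilon> > 0" "inverse (y \<epsilon> - x \<epsilon>) \<le> inverse (\<epsilon> ^ q)"
      by (linarith, metis le_imp_inverse_le)
    then show ?case using elim by (simp add: w_def power_one_over inverse_eq_divide)
  qed
  then have w: "moderate w" by (rule moderate_bound[OF moderate_inverse_power])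
  have "\<forall>\<^sub>F \<epsilon> in at_right 0. norm (1 - (y \<epsilon> - x \<epsilon>) * w \<epsilon>) \<le> norm (0::real)"
    using q
  proof eventually_elim
    case (elim \<epsilon>)
    then have "\<epsilon> ^ q > 0" by simp
    with elim have "y \<epsilon> - x \<epsilon> > 0" by linarith
    then show ?case by (simp add: w_def)
  qed
  then have "null_net (\<lambda>\<epsilon>. 1 - (y \<epsilon> - x \<epsilon>) * w \<epsilon>)" by (rule null_net_bound[OF null_net_zero])
  then have "1 = abs_gen (\<lambda>\<epsilon>. (y \<epsilon> - x \<epsilon>) * w \<epsilon>)"
    unfolding one_gen_def
    using w moderate_diff[OF assms(2,1)] by (simp add: abs_gen_eq_iff moderate_const moderate_mult)
  also have "\<dots> = abs_gen (\<lambda>\<epsilon>. y \<epsilon> - x \<epsilon>) * abs_gen w"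
    using w moderate_diff[OF assms(2,1)] by (simp add: times_gen.abs_eq net_equiv_self)
  finally show "abs_gen x <\<^sub>g abs_gen y"
    using le assms unfolding gless_def by (simp add: abs_gen_diff dvdI)
qed

section \<open>Sharp neighbourhoods in terms of nets\<close>

lemma moderate_near:
  assumes "moderate x" "\<forall>\<^sub>F \<epsilon> in at_right 0. norm (y \<epsilon> - x \<epsilon>) \<le> \<epsilon> ^ q"
  shows "moderate y"
proof -
  have "moderate (\<lambda>\<epsilon>. y \<epsilon> - x \<epsilon>)"
  proof (rule moderate_bound[OF moderate_const[of "1::real"]])
    show "\<forall>\<^sub>F \<epsilon> in at_right 0. norm (y \<epsilon> - x \<epsilon>) \<le> norm (1::real)"
      using assms(2) eventually_small[OF zero_less_one]
    proof eventually_elim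
      case (elim \<epsilon>)
      then have "\<epsilon> ^ q \<le> 1" by (simp add: power_le_one)
      with elim show ?case by simp
    qed
  qed
  from moderate_add[OF assms(1) this] show ?thesis by simp
qed

text \<open>Radii \<open>\<epsilon> ^ q\<close> suffice because a strict inequality between
  generalized numbers leaves room of that size. The induction follows the generation of the topology
  from its balls; moderateness of \<open>y\<close> comes from its closeness to
  \<open>x\<close>.\<close>

lemma sharply_open_contains_ball:
  assumes "openin sharp_topology U" "moderate x" "abs_gen x \<in> U"
  obtains q where "\<And>y. \<forall>\<^sub>F \<epsilon> in at_right 0. norm (y \<epsilon> - x \<epsilon>) \<le> \<epsilon> ^ q \<Longrightarrow> abs_gen y \<in> U"
proof -
  have "generate_topology_on {{y. gabs (y - x) <\<^sub>g \<rho>} | x \<rho>. 0 <\<^sub>g \<rho>} U"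
    using assms(1) unfolding sharp_topology_def openin_topology_generated_by_iff .
  then have "abs_gen x \<in> U \<longrightarrow>
      (\<exists>q. \<forall>y. (\<forall>\<^sub>F \<epsilon> in at_right 0. norm (y \<epsilon> - x \<epsilon>) \<le> \<epsilon> ^ q) \<longrightarrow> abs_gen y \<in> U)"
  proof induction
    case Empty
    then show ?case by simp
  next
    case (Int A B)
    show ?case
    proof
      assume "abs_gen x \<in> A \<inter> B"
      with Int.IH obtain p q where
        p: "\<And>y. \<forall>\<^sub>F \<epsilon> in at_right 0. norm (y \<epsilon> - x \<epsilon>) \<le> \<epsilon> ^ p \<Longrightarrow> abs_gen y \<in> A" and
        q: "\<And>y. \<forall>\<^sub>F \<epsilon> in at_right 0. norm (y \<epsilon> - x \<epsilon>) \<le> \<epsilon> ^ q \<Longrightarrow> abs_gen y \<in> B"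
        by blast
      have "abs_gen y \<in> A \<inter> B" if y: "\<forall>\<^sub>F \<epsilon> in at_right 0. norm (y \<epsilon> - x \<epsilon>) \<le> \<epsilon> ^ (p + q)" for y
      proof
        have *: "\<epsilon> ^ (p + q) \<le> \<epsilon> ^ p" "\<epsilon> ^ (p + q) \<le> \<epsilon> ^ q" if "0 < \<epsilon> \<and> \<epsilon> < 1" for \<epsilon> :: real
          using that by (auto intro: power_decreasing)
        have "\<forall>\<^sub>F \<epsilon> in at_right 0. norm (y \<epsilon> - x \<epsilon>) \<le> \<epsilon> ^ p"
          using y eventually_small[OF zero_less_one] by eventually_elim (meson * order_trans)
        then show "abs_gen y \<in> A" by (rule p)
        have "\<forall>\<^sub>F \<epsilon> in at_right 0. norm (y \<epsilon> - x \<epsilon>) \<le> \<epsilon> ^ q"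
          using y eventually_small[OF zero_less_one] by eventually_elim (meson * order_trans)
        then show "abs_gen y \<in> B" by (rule q)
      qed
      then show "\<exists>q. \<forall>y. (\<forall>\<^sub>F \<epsilon> in at_right 0. norm (y \<epsilon> - x \<epsilon>) \<le> \<epsilon> ^ q) \<longrightarrow> abs_gen y \<in> A \<inter> B"
        by blast
    qed
  next
    case (UN S)
    show ?case
    proof
      assume "abs_gen x \<in> \<Union>S"
      then obtain A where "A \<in> S" "abs_gen x \<in> A" by blast
      with UN.IH[of A] show "\<exists>q. \<forall>y. (\<forall>\<^sub>F \<epsilon> in at_right 0. norm (y \<epsilon> - x \<epsilon>) \<le> \<epsilon> ^ q) \<longrightarrow> abs_gen y \<in> \<Union>S"
        by blast
    qed
  next
    case (Basis A)
    then obtain c \<rho> where A: "A = {y. gabs (y - c) <\<^sub>g \<rho>}" by blast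
    define c' \<rho>' where "c' = rep_gen c" and "\<rho>' = rep_gen \<rho>"
    have m: "moderate c'" "moderate \<rho>'" by (simp_all add: c'_def \<rho>'_def moderate_rep_gen)
    have A_iff: "abs_gen y \<in> A \<longleftrightarrow> (\<exists>q. \<forall>\<^sub>F \<epsilon> in at_right 0. \<epsilon> ^ q \<le> \<rho>' \<epsilon> - norm (y \<epsilon> - c' \<epsilon>))"
      if "moderate y" for y
    proof -
      have "gabs (abs_gen y - c) = abs_gen (\<lambda>\<epsilon>. norm (y \<epsilon> - c' \<epsilon>))"
        using abs_gen_diff[OF that m(1)] gabs_abs_gen[OF moderate_diff[OF that m(1)]]
        by (simp add: c'_def)
      then show ?thesis
        using gless_abs_gen_iff[OF moderate_norm[OF moderate_diff[OF that m(1)]] m(2)]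
        by (simp add: A \<rho>'_def)
    qed
    show ?case
    proof
      assume "abs_gen x \<in> A"
      then obtain q where q: "\<forall>\<^sub>F \<epsilon> in at_right 0. \<epsilon> ^ q \<le> \<rho>' \<epsilon> - norm (x \<epsilon> - c' \<epsilon>)"
        using A_iff[OF assms(2)] by blast
      \<comment> \<open>The ball is centred at \<open>c\<close>, not at \<open>x\<close>. The room
        \<open>\<epsilon> ^ q\<close> left at \<open>x\<close> is at least twice
        \<open>\<epsilon> ^ Suc q\<close>: one share pays for the move to \<open>y\<close>, the
        other keeps the inequality strict.\<close>
      have "abs_gen y \<in> A" if y: "\<forall>\<^sub>F \<epsilon> in at_right 0. norm (y \<epsilon> - x \<epsilon>) \<le> \<epsilon> ^ Suc q" for y
      proof -
        have "\<forall>\<^sub>F \<epsilon>::real in at_right 0. 0 < \<epsilon> \<and> \<epsilon> < 1/2" by (rule eventually_small) simp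
        with q y have "\<forall>\<^sub>F \<epsilon> in at_right 0. \<epsilon> ^ Suc q \<le> \<rho>' \<epsilon> - norm (y \<epsilon> - c' \<epsilon>)"
        proof eventually_elim
          case (elim \<epsilon>)
          have "norm (y \<epsilon> - c' \<epsilon>) \<le> norm (y \<epsilon> - x \<epsilon>) + norm (x \<epsilon> - c' \<epsilon>)"
            using norm_triangle_ineq[of "y \<epsilon> - x \<epsilon>" "x \<epsilon> - c' \<epsilon>"] by simp
          moreover have "\<epsilon> * \<epsilon> ^ q \<le> 1/2 * \<epsilon> ^ q"
            using elim by (intro mult_right_mono) auto
          ultimately show ?case using elim unfolding power_Suc by linarith
        qed
        then show ?thesis using A_iff[OF moderate_near[OF assms(2) y]] by blast
      qed
      then show "\<exists>q. \<forall>y. (\<forall>\<^sub>F \<epsilon> in at_right 0. norm (y \<epsilon> - x \<epsilon>) \<le> \<epsilon> ^ q) \<longrightarrow> abs_gen y \<in> A" by blast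
    qed
  qed
  with assms(3) that show ?thesis by blast
qed


section \<open>Derivatives of generalized smooth functions\<close>

lemma partial_has_real_derivative:
  assumes "u differentiable (at (x + t *\<^sub>R axis i 1))"
  shows "((\<lambda>s. u (x + s *\<^sub>R axis i 1)) has_real_derivative partial i u (x + t *\<^sub>R axis i 1)) (at t)"
proof -
  define z where "z = x + t *\<^sub>R axis i 1"
  have "(u \<circ> (\<lambda>s. z + s *\<^sub>R axis i 1)) differentiable (at 0)"
    using assms by (intro differentiable_chain_at) (auto simp: z_def)
  then have "((\<lambda>s. u (z + s *\<^sub>R axis i 1)) has_real_derivative partial i u z) (at (t + (- t)))"
    by (auto simp: o_def partial_def real_differentiable_def intro: DERIV_imp_deriv[THEN ssubst])
  then have "((\<lambda>s. u (z + (s + (- t)) *\<^sub>R axis i 1)) has_real_derivative partial i u z) (at t)"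
    by (rule iffD1[OF DERIV_shift])
  then show ?thesis by (simp add: z_def algebra_simps)
qed

lemma partial_eq_frechet_derivative:
  assumes "(u has_derivative D) (at x)"
  shows "partial i u x = D (axis i 1)"
proof -
  have "((\<lambda>t. x + t *\<^sub>R axis i 1) has_derivative (\<lambda>t. t *\<^sub>R axis i 1)) (at (0::real))"
    by (auto intro!: derivative_eq_intros)
  moreover have "(u has_derivative D) (at (x + 0 *\<^sub>R axis i 1))" using assms by simp
  ultimately have "(u \<circ> (\<lambda>t. x + t *\<^sub>R axis i 1) has_derivative D \<circ> (\<lambda>t. t *\<^sub>R axis i 1)) (at (0::real))"
    by (rule diff_chain_at)
  moreover have "D \<circ> (\<lambda>t. t *\<^sub>R axis i 1) = (*) (D (axis i 1))"
    using linear_scale[OF has_derivative_linear[OF assms]] by (auto simp: mult.commute)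
  ultimately have "((\<lambda>t. u (x + t *\<^sub>R axis i 1)) has_real_derivative D (axis i 1)) (at 0)"
    unfolding has_field_derivative_def by (simp add: o_def)
  then show ?thesis unfolding partial_def by (rule DERIV_imp_deriv)
qed

text \<open>Expanding the differential in the standard basis bounds its operator norm by the number
  of coordinates times \<open>B\<close>; the mean value inequality does the rest.\<close>

lemma partial_bound_imp_lipschitz:
  fixes u :: "real^'n::finite \<Rightarrow> real"
  assumes diff: "\<And>x. u differentiable (at x)" and bnd: "\<And>i x. \<bar>partial i u x\<bar> \<le> B"
  shows "\<bar>u x - u y\<bar> \<le> (real CARD('n) * B) * norm (x - y)"
proof -
  define D where "D z = frechet_derivative u (at z)" for z
  have D: "(u has_derivative D z) (at z)" for z
    unfolding D_def using diff frechet_derivative_works by blast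
  have "onorm (D z) \<le> real CARD('n) * B" for z
  proof (rule onorm_le)
    fix h :: "real^'n"
    have "D z h = D z (\<Sum>i\<in>UNIV. (h $ i) *\<^sub>R axis i 1)"
      using basis_expansion[of h] by (simp add: scalar_mult_eq_scaleR)
    also have "\<dots> = (\<Sum>i\<in>UNIV. h $ i * partial i u z)"
      using has_derivative_linear[OF D[of z]]
      by (simp add: linear_sum linear_scale partial_eq_frechet_derivative[OF D])
    finally have "norm (D z h) \<le> (\<Sum>i\<in>UNIV. \<bar>h $ i\<bar> * \<bar>partial i u z\<bar>)"
      by (simp add: abs_mult[symmetric] sum_abs)
    also have "\<dots> \<le> (\<Sum>i\<in>(UNIV::'n set). norm h * B)"
      by (intro sum_mono mult_mono bnd component_le_norm_cart) auto
    finally show "norm (D z h) \<le> real CARD('n) * B * norm h" by (simp add: mult_ac)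
  qed
  then have "norm (u x - u y) \<le> real CARD('n) * B * norm (x - y)"
    using D by (intro differentiable_bound[where S = UNIV and f' = D]) auto
  then show ?thesis by simp
qed

text \<open>The list of differentiation directions in \<open>mderiv\<close>, with the enumeration of
  the coordinates as a parameter, so that induction on it is possible.\<close>

definition mindex_list :: "('n \<Rightarrow> nat) \<Rightarrow> 'n list \<Rightarrow> 'n list" where
  "mindex_list \<alpha> cs = concat (map (\<lambda>i. replicate (\<alpha> i) i) cs)"

lemma mindex_list_cong: "(\<And>i. i \<in> set cs \<Longrightarrow> \<alpha> i = \<beta> i) \<Longrightarrow> mindex_list \<alpha> cs = mindex_list \<beta> cs"
  unfolding mindex_list_def by (metis (no_types, lifting) map_eq_conv)

text \<open>Moderateness is only assumed for partial derivatives in the order of \<open>coords\<close>. For the first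
  index \<open>i\<close> that occurs in \<open>\<alpha>\<close>, raising or lowering \<open>\<alpha> i\<close> prepends or removes an \<open>i\<close>, so the second
  derivative needed below is again of this form and symmetry of derivatives is not used.\<close>

lemma mindex_list_decompose:
  assumes "distinct cs" "\<exists>i\<in>set cs. \<alpha> i > 0"
  shows "\<exists>i\<in>set cs. \<alpha> i > 0 \<and> mindex_list \<alpha> cs = i # mindex_list (\<alpha>(i := \<alpha> i - 1)) cs \<and>
    mindex_list (\<alpha>(i := Suc (\<alpha> i))) cs = i # mindex_list \<alpha> cs"
  using assms
proof (induction cs)
  case (Cons c cs)
  show ?case
  proof (cases "\<alpha> c > 0")
    case True
    then obtain k where k: "\<alpha> c = Suc k" by (auto simp: gr0_conv_Suc)
    have "mindex_list (\<alpha>(c := j)) cs = mindex_list \<alpha> cs" for j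
      using Cons.prems by (intro mindex_list_cong) auto
    then show ?thesis
      by (intro bexI[of _ c]) (auto simp: mindex_list_def k)
  next
    case False
    with Cons.prems have "\<exists>i\<in>set cs. \<alpha> i > 0" by auto
    then obtain i where i: "i \<in> set cs" "\<alpha> i > 0"
        "mindex_list \<alpha> cs = i # mindex_list (\<alpha>(i := \<alpha> i - 1)) cs"
        "mindex_list (\<alpha>(i := Suc (\<alpha> i))) cs = i # mindex_list \<alpha> cs"
      using Cons.IH Cons.prems(1) by fastforce
    moreover have "i \<noteq> c" using i(1) Cons.prems by auto
    ultimately show ?thesis
      using False by (intro bexI[of _ i]) (auto simp: mindex_list_def)
  qed
qed simp

lemma coords: "distinct (coords :: 'n::finite list)" "set (coords :: 'n list) = UNIV"
proof -
  have "\<exists>is. distinct is \<and> set is = (UNIV :: 'n set)"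
    using finite_distinct_list[of "UNIV :: 'n set"] by auto
  from someI_ex[OF this] show "distinct (coords :: 'n list)" "set (coords :: 'n list) = UNIV"
    unfolding coords_def by auto
qed

lemma mderiv_mindex_list: "mderiv \<alpha> u = foldr partial (mindex_list \<alpha> coords) u"
  by (simp add: mderiv_def mindex_list_def)

lemma mderiv_zero_index [simp]: "mderiv (\<lambda>_. 0) u = u"
  by (simp add: mderiv_def concat_replicate_trivial map_replicate_const)

lemma mderiv_decompose:
  fixes \<alpha> :: "'n::finite \<Rightarrow> nat"
  assumes "\<alpha> \<noteq> (\<lambda>_. 0)"
  obtains i where "\<alpha> i > 0" "\<And>u. mderiv \<alpha> u = partial i (mderiv (\<alpha>(i := \<alpha> i - 1)) u)"
    "\<And>u. mderiv (\<alpha>(i := Suc (\<alpha> i))) u = partial i (mderiv \<alpha> u)"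
proof -
  have "\<exists>i\<in>set coords. \<alpha> i > 0" using assms unfolding coords(2) by (auto simp: fun_eq_iff)
  from mindex_list_decompose[OF coords(1) this] that show ?thesis
    by (auto simp: mderiv_mindex_list)
qed

lemma mderiv_unit: "mderiv ((\<lambda>_. 0)(i := 1)) u = partial i u"
proof -
  obtain j where "((\<lambda>_. 0)(i := 1::nat)) j > 0"
      "mderiv ((\<lambda>_. 0)(i := 1)) u = partial j (mderiv (((\<lambda>_. 0)(i := 1))(j := ((\<lambda>_. 0)(i := 1::nat)) j - 1)) u)"
    by (rule mderiv_decompose[of "(\<lambda>_. 0)(i := 1)"]) (auto simp: fun_eq_iff)
  then show ?thesis by (auto split: if_splits simp: fun_upd_def cong: if_cong)
qed

section \<open>Negligible values force negligible derivatives\<close>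

lemma smooth_on_mderiv_differentiable:
  assumes "smooth_on S u" "x \<in> S"
  shows "mderiv \<alpha> u differentiable (at x)" "partial i (mderiv \<alpha> u) differentiable (at x)"
    "partial i (partial i (mderiv \<alpha> u)) differentiable (at x)"
proof -
  have *: "foldr partial is u differentiable (at x)" for "is"
    using assms unfolding smooth_on_def by blast
  show "mderiv \<alpha> u differentiable (at x)" using * unfolding mderiv_mindex_list .
  show "partial i (mderiv \<alpha> u) differentiable (at x)"
    using *[of "i # mindex_list \<alpha> coords"] unfolding mderiv_mindex_list by simp
  show "partial i (partial i (mderiv \<alpha> u)) differentiable (at x)"
    using *[of "i # i # mindex_list \<alpha> coords"] unfolding mderiv_mindex_list by simp
qed

text \<open>The mean value theorem is applied twice: the quotient is the derivative at an
  intermediate point, and moving from there back to \<open>x\<close> costs at most \<open>h\<close>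
  times the second derivative.\<close>

lemma partial_le_difference_quotient:
  fixes w :: "real^'n::finite \<Rightarrow> real"
  assumes "h > 0"
    and diff: "\<And>t. \<lbrakk>0 \<le> t; t \<le> h\<rbrakk> \<Longrightarrow> w differentiable (at (x + t *\<^sub>R axis i 1))"
      "\<And>t. \<lbrakk>0 \<le> t; t \<le> h\<rbrakk> \<Longrightarrow> partial i w differentiable (at (x + t *\<^sub>R axis i 1))"
    and bnd: "\<And>t. \<lbrakk>0 \<le> t; t \<le> h\<rbrakk> \<Longrightarrow> \<bar>partial i (partial i w) (x + t *\<^sub>R axis i 1)\<bar> \<le> M"
  shows "\<bar>partial i w x\<bar> \<le> \<bar>w (x + h *\<^sub>R axis i 1) - w x\<bar> / h + h * M"
proof -
  have "\<exists>z>0. z < h \<and> w (x + h *\<^sub>R axis i 1) - w (x + 0 *\<^sub>R axis i 1)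
      = (h - 0) * partial i w (x + z *\<^sub>R axis i 1)"
    by (rule MVT2[OF \<open>h > 0\<close>]) (use partial_has_real_derivative diff in blast)
  then obtain z where z: "0 < z" "z < h"
      "w (x + h *\<^sub>R axis i 1) - w x = h * partial i w (x + z *\<^sub>R axis i 1)" by auto
  have "DERIV (\<lambda>t. partial i w (x + t *\<^sub>R axis i 1)) t :> partial i (partial i w) (x + t *\<^sub>R axis i 1)"
    if "0 \<le> t" "t \<le> z" for t
    using that z by (intro partial_has_real_derivative diff(2)) auto
  from MVT2[OF \<open>z > 0\<close> this] have "\<exists>s>0. s < z \<and> partial i w (x + z *\<^sub>R axis i 1) - partial i w (x + 0 *\<^sub>R axis i 1)
      = (z - 0) * partial i (partial i w) (x + s *\<^sub>R axis i 1)" by blast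
  then obtain s where s: "0 < s" "s < z" "partial i w (x + z *\<^sub>R axis i 1) - partial i w x
      = z * partial i (partial i w) (x + s *\<^sub>R axis i 1)" by auto
  have "\<bar>z * partial i (partial i w) (x + s *\<^sub>R axis i 1)\<bar> \<le> h * M"
    unfolding abs_mult using s z bnd[of s] by (intro mult_mono) auto
  moreover have "\<bar>partial i w (x + z *\<^sub>R axis i 1)\<bar> = \<bar>w (x + h *\<^sub>R axis i 1) - w x\<bar> / h"
    using z \<open>h > 0\<close> by (simp add: abs_mult)
  ultimately show ?thesis using s(3) by linarith
qed

text \<open>Membership of generalized points becomes inclusion of balls at fixed \<epsilon> by an
  adversarial choice: \<open>y \<epsilon>\<close> is taken outside
  \<open>\<Omega> \<epsilon>\<close> whenever the ball has such a point. The class of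
  \<open>y\<close> lies in \<open>U\<close>, so this can succeed for no small \<epsilon>.\<close>

lemma strongly_internal_contains_cball:
  assumes "U \<subseteq> strongly_internal_set \<Omega>" "moderate x"
    and "\<And>y. \<forall>\<^sub>F \<epsilon> in at_right 0. norm (y \<epsilon> - x \<epsilon>) \<le> \<epsilon> ^ q \<Longrightarrow> abs_gen y \<in> U"
  shows "\<forall>\<^sub>F \<epsilon> in at_right 0. cball (x \<epsilon>) (\<epsilon> ^ q) \<subseteq> \<Omega> \<epsilon>"
proof -
  have "\<exists>y. norm (y - x \<epsilon>) \<le> \<epsilon> ^ q \<and> (y \<in> \<Omega> \<epsilon> \<longrightarrow> cball (x \<epsilon>) (\<epsilon> ^ q) \<subseteq> \<Omega> \<epsilon>)" if "\<epsilon> > 0" for \<epsilon>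
  proof (cases "cball (x \<epsilon>) (\<epsilon> ^ q) \<subseteq> \<Omega> \<epsilon>")
    case True
    then show ?thesis using that by (intro exI[of _ "x \<epsilon>"]) simp
  next
    case False
    then show ?thesis by (auto simp: dist_norm norm_minus_commute)
  qed
  then obtain y where y: "\<And>\<epsilon>. \<epsilon> > 0 \<Longrightarrow> norm (y \<epsilon> - x \<epsilon>) \<le> \<epsilon> ^ q"
      "\<And>\<epsilon>. \<epsilon> > 0 \<Longrightarrow> y \<epsilon> \<in> \<Omega> \<epsilon> \<Longrightarrow> cball (x \<epsilon>) (\<epsilon> ^ q) \<subseteq> \<Omega> \<epsilon>" by metis
  have near: "\<forall>\<^sub>F \<epsilon> in at_right 0. norm (y \<epsilon> - x \<epsilon>) \<le> \<epsilon> ^ q"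
    using eventually_small[OF zero_less_one] by eventually_elim (simp add: y(1))
  then have "abs_gen y \<in> strongly_internal_set \<Omega>" using assms(1,3) by blast
  then obtain z where z: "abs_gen y = abs_gen z" "moderate z"
      "\<And>y. net_equiv y z \<Longrightarrow> \<forall>\<^sub>F \<epsilon> in at_right 0. y \<epsilon> \<in> \<Omega> \<epsilon>"
    unfolding strongly_internal_set_def by blast
  have "moderate y" using moderate_near[OF assms(2) near] .
  then have "net_equiv y z" using z abs_gen_eq_iff[of y z] by (simp add: net_equiv_def)
  from z(3)[OF this] eventually_small[OF zero_less_one] show ?thesis
    by eventually_elim (simp add: y(2))
qed

text \<open>For \<open>h = \<epsilon>\<^sup>r\<close> the difference quotient of \<open>w\<^sub>\<epsilon>\<close> is negligible and its error is \<open>h\<close> times a second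
  derivative. To bound the latter by a power of \<open>1 / \<epsilon>\<close> that does not depend on \<open>r\<close>, it is maximised
  over a ball of fixed radius \<open>\<epsilon>\<^sup>q\<close>, at a generalized point \<open>\<zeta>\<close> of \<open>U\<close>.\<close>

lemma partial_null_net:
  fixes w :: "real \<Rightarrow> real^'n::finite \<Rightarrow> real"
  assumes U: "openin sharp_topology U" "U \<subseteq> strongly_internal_set \<Omega>"
    and diff: "\<And>\<epsilon> x. \<lbrakk>\<epsilon> \<in> {0<..1}; x \<in> \<Omega> \<epsilon>\<rbrakk> \<Longrightarrow> w \<epsilon> differentiable (at x)"
      "\<And>\<epsilon> x. \<lbrakk>\<epsilon> \<in> {0<..1}; x \<in> \<Omega> \<epsilon>\<rbrakk> \<Longrightarrow> partial i (w \<epsilon>) differentiable (at x)"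
      "\<And>\<epsilon> x. \<lbrakk>\<epsilon> \<in> {0<..1}; x \<in> \<Omega> \<epsilon>\<rbrakk> \<Longrightarrow> partial i (partial i (w \<epsilon>)) differentiable (at x)"
    and null: "\<And>x. \<lbrakk>moderate x; abs_gen x \<in> U\<rbrakk> \<Longrightarrow> null_net (\<lambda>\<epsilon>. w \<epsilon> (x \<epsilon>))"
    and mod: "\<And>x. \<lbrakk>moderate x; abs_gen x \<in> U\<rbrakk> \<Longrightarrow> moderate (\<lambda>\<epsilon>. partial i (partial i (w \<epsilon>)) (x \<epsilon>))"
    and x: "moderate x" "abs_gen x \<in> U"
  shows "null_net (\<lambda>\<epsilon>. partial i (w \<epsilon>) (x \<epsilon>))"
proof -
  obtain q where q: "\<And>y. \<forall>\<^sub>F \<epsilon> in at_right 0. norm (y \<epsilon> - x \<epsilon>) \<le> \<epsilon> ^ q \<Longrightarrow> abs_gen y \<in> U"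
    using sharply_open_contains_ball[OF U(1) x] by blast
  have sub: "\<forall>\<^sub>F \<epsilon> in at_right 0. cball (x \<epsilon>) (\<epsilon> ^ q) \<subseteq> \<Omega> \<epsilon>"
    by (rule strongly_internal_contains_cball[OF U(2) x(1) q])
  define w2 where "w2 \<epsilon> = partial i (partial i (w \<epsilon>))" for \<epsilon>
  have "\<exists>\<zeta>\<in>cball (x \<epsilon>) (\<epsilon> ^ q). \<forall>y\<in>cball (x \<epsilon>) (\<epsilon> ^ q). \<bar>w2 \<epsilon> y\<bar> \<le> \<bar>w2 \<epsilon> \<zeta>\<bar>"
    if "\<epsilon> \<in> {0<..1}" "cball (x \<epsilon>) (\<epsilon> ^ q) \<subseteq> \<Omega> \<epsilon>" for \<epsilon>
  proof (rule continuous_attains_sup)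
    show "continuous_on (cball (x \<epsilon>) (\<epsilon> ^ q)) (\<lambda>y. \<bar>w2 \<epsilon> y\<bar>)"
      unfolding w2_def using diff(3)[OF that(1)] that(2)
      by (intro continuous_on_rabs continuous_at_imp_continuous_on ballI differentiable_imp_continuous_within) auto
  qed (use that in auto)
  then obtain \<zeta> where \<zeta>: "\<And>\<epsilon>. \<epsilon> \<in> {0<..1} \<Longrightarrow> cball (x \<epsilon>) (\<epsilon> ^ q) \<subseteq> \<Omega> \<epsilon> \<Longrightarrow>
      \<zeta> \<epsilon> \<in> cball (x \<epsilon>) (\<epsilon> ^ q) \<and> (\<forall>y\<in>cball (x \<epsilon>) (\<epsilon> ^ q). \<bar>w2 \<epsilon> y\<bar> \<le> \<bar>w2 \<epsilon> (\<zeta> \<epsilon>)\<bar>)"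
    by metis
  have near: "\<forall>\<^sub>F \<epsilon> in at_right 0. norm (\<zeta> \<epsilon> - x \<epsilon>) \<le> \<epsilon> ^ q"
    using sub eventually_small[OF zero_less_one]
  proof eventually_elim
    case (elim \<epsilon>)
    then have "\<zeta> \<epsilon> \<in> cball (x \<epsilon>) (\<epsilon> ^ q)" using \<zeta>[of \<epsilon>] by auto
    then show ?case by (simp add: dist_norm norm_minus_commute)
  qed
  have "moderate (\<lambda>\<epsilon>. w2 \<epsilon> (\<zeta> \<epsilon>))"
    unfolding w2_def by (intro mod moderate_near[OF x(1) near] q near)
  then obtain N where N: "\<forall>\<^sub>F \<epsilon> in at_right 0. norm (w2 \<epsilon> (\<zeta> \<epsilon>)) \<le> (1 / \<epsilon>) ^ N"
    unfolding moderate_iff by blast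
  show ?thesis
    unfolding null_net_iff
  proof
    fix m
    \<comment> \<open>The summand \<open>q\<close> keeps the segment inside the ball of radius
      \<open>\<epsilon> ^ q\<close>, \<open>N\<close> cancels the growth of the second derivative,
      and \<open>Suc m\<close> leaves one power of \<epsilon> to absorb constants.\<close>
    define r where "r = q + N + Suc m"
    define y where "y \<epsilon> = x \<epsilon> + (\<epsilon> ^ r) *\<^sub>R axis i 1" for \<epsilon>
    have y_near: "\<forall>\<^sub>F \<epsilon> in at_right 0. norm (y \<epsilon> - x \<epsilon>) \<le> \<epsilon> ^ q"
      using eventually_small[OF zero_less_one]
      proof eventually_elim
        case (elim \<epsilon>)
        then have "\<epsilon> ^ r \<le> \<epsilon> ^ q" by (intro power_decreasing) (auto simp: r_def)
        with elim show ?case by (simp add: y_def)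
      qed
    have "null_net (\<lambda>\<epsilon>. w \<epsilon> (y \<epsilon>))" "null_net (\<lambda>\<epsilon>. w \<epsilon> (x \<epsilon>))"
      by (intro null moderate_near[OF x(1) y_near] q y_near x)+
    then have "\<forall>\<^sub>F \<epsilon> in at_right 0. norm (w \<epsilon> (y \<epsilon>)) \<le> \<epsilon> ^ (r + Suc m)"
        "\<forall>\<^sub>F \<epsilon> in at_right 0. norm (w \<epsilon> (x \<epsilon>)) \<le> \<epsilon> ^ (r + Suc m)"
      unfolding null_net_iff by blast+
    \<comment> \<open>The estimate below ends in \<open>3 * \<epsilon> ^ Suc m\<close>, from two
      values of \<open>w\<close> and one second-order error; hence 1/3.\<close>
    moreover have "\<forall>\<^sub>F \<epsilon>::real in at_right 0. 0 < \<epsilon> \<and> \<epsilon> < 1/3" by (rule eventually_small) simp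
    ultimately show "\<forall>\<^sub>F \<epsilon> in at_right 0. norm (partial i (w \<epsilon>) (x \<epsilon>)) \<le> \<epsilon> ^ m"
      using sub N
    proof eventually_elim
      case (elim \<epsilon>)
      define h where "h = \<epsilon> ^ r"
      have \<epsilon>: "0 < \<epsilon>" "\<epsilon> < 1/3" "\<epsilon> \<in> {0<..1}" "h > 0"
        using elim by (auto simp: h_def)
      then have "h \<le> \<epsilon> ^ q" unfolding h_def by (intro power_decreasing) (auto simp: r_def)
      have seg: "x \<epsilon> + t *\<^sub>R axis i 1 \<in> cball (x \<epsilon>) (\<epsilon> ^ q)" if "0 \<le> t" "t \<le> h" for t
        using that \<open>h \<le> \<epsilon> ^ q\<close> by (simp add: dist_norm)
      have seg': "x \<epsilon> + t *\<^sub>R axis i 1 \<in> \<Omega> \<epsilon>" if "0 \<le> t" "t \<le> h" for t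
        using seg[OF that] elim by blast
      have "\<bar>partial i (w \<epsilon>) (x \<epsilon>)\<bar> \<le> \<bar>w \<epsilon> (x \<epsilon> + h *\<^sub>R axis i 1) - w \<epsilon> (x \<epsilon>)\<bar> / h + h * \<bar>w2 \<epsilon> (\<zeta> \<epsilon>)\<bar>"
      proof (rule partial_le_difference_quotient[OF \<epsilon>(4)])
        fix t assume t: "0 \<le> t" "t \<le> h"
        show "w \<epsilon> differentiable (at (x \<epsilon> + t *\<^sub>R axis i 1))"
            "partial i (w \<epsilon>) differentiable (at (x \<epsilon> + t *\<^sub>R axis i 1))"
          using diff(1,2)[OF \<epsilon>(3) seg'[OF t]] by auto
        show "\<bar>partial i (partial i (w \<epsilon>)) (x \<epsilon> + t *\<^sub>R axis i 1)\<bar> \<le> \<bar>w2 \<epsilon> (\<zeta> \<epsilon>)\<bar>"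
          using \<zeta>[OF \<epsilon>(3)] elim seg[OF t] unfolding w2_def by blast
      qed
      also have "\<dots> \<le> (2 * \<epsilon> ^ (r + Suc m)) / h + h * (1 / \<epsilon>) ^ N"
        using elim \<epsilon>(4) by (intro add_mono divide_right_mono mult_left_mono) (auto simp: y_def h_def)
      also have "\<dots> = 2 * \<epsilon> ^ Suc m + \<epsilon> ^ q * \<epsilon> ^ Suc m"
        using \<epsilon>(1) by (simp add: h_def r_def power_add power_one_over)
      also have "\<dots> \<le> 2 * \<epsilon> ^ Suc m + 1 * \<epsilon> ^ Suc m"
        using \<epsilon> by (intro add_left_mono mult_right_mono power_le_one) auto
      also have "\<dots> = (3 * \<epsilon>) * \<epsilon> ^ m" by simp
      also have "\<dots> \<le> 1 * \<epsilon> ^ m"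
        using \<epsilon> by (intro mult_right_mono) auto
      finally show ?case by simp
    qed
  qed
qed

text \<open>Each order follows from the one below it, while moderateness of the order above controls
  the error. The point is kept arbitrary in the induction because a difference quotient involves
  neighbours of \<open>x\<close>.\<close>

lemma mderiv_null_net:
  fixes u :: "real \<Rightarrow> real^'n::finite \<Rightarrow> real"
  assumes U: "openin sharp_topology U" and u: "defines_gsf \<Omega> u U (\<lambda>_. 0)"
    and x: "moderate x" "abs_gen x \<in> U"
  shows "null_net (\<lambda>\<epsilon>. mderiv \<alpha> (u \<epsilon>) (x \<epsilon>))"
  using x
proof (induction "sum \<alpha> UNIV" arbitrary: \<alpha> x rule: less_induct)
  case less
  have smooth: "\<And>\<epsilon>. \<epsilon> \<in> {0<..1} \<Longrightarrow> smooth_on (\<Omega> \<epsilon>) (u \<epsilon>)"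
    and sub: "U \<subseteq> strongly_internal_set \<Omega>"
    and mod: "\<And>\<alpha> x. moderate x \<Longrightarrow> abs_gen x \<in> U \<Longrightarrow> moderate (\<lambda>\<epsilon>. mderiv \<alpha> (u \<epsilon>) (x \<epsilon>))"
    and val: "\<And>x. moderate x \<Longrightarrow> abs_gen x \<in> U \<Longrightarrow> abs_gen (\<lambda>\<epsilon>. u \<epsilon> (x \<epsilon>)) = 0"
    using u unfolding defines_gsf_def by auto
  show ?case
  proof (cases "\<alpha> = (\<lambda>_. 0)")
    case True
    have "moderate (\<lambda>\<epsilon>. u \<epsilon> (x \<epsilon>))" using mod[OF less.prems, of "\<lambda>_. 0"] by simp
    then show ?thesis
      using val[OF less.prems] abs_gen_eq_iff[of "\<lambda>\<epsilon>. u \<epsilon> (x \<epsilon>)" "\<lambda>_. 0"]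
      by (simp add: True zero_gen_def moderate_const)
  next
    case False
    then obtain i where i: "\<alpha> i > 0" "\<And>u. mderiv \<alpha> u = partial i (mderiv (\<alpha>(i := \<alpha> i - 1)) u)"
        "\<And>u. mderiv (\<alpha>(i := Suc (\<alpha> i))) u = partial i (mderiv \<alpha> u)"
      by (rule mderiv_decompose) blast
    define \<beta> where "\<beta> = \<alpha>(i := \<alpha> i - 1)"
    have "sum \<beta> UNIV < sum \<alpha> UNIV"
      using i(1) by (intro sum_strict_mono_ex1) (auto simp: \<beta>_def)
    then have null: "null_net (\<lambda>\<epsilon>. mderiv \<beta> (u \<epsilon>) (y \<epsilon>))" if "moderate y" "abs_gen y \<in> U" for y
      using less.hyps that by blast
    have eq: "mderiv \<alpha> u = partial i (mderiv \<beta> u)"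
        "mderiv (\<alpha>(i := Suc (\<alpha> i))) u = partial i (partial i (mderiv \<beta> u))" for u
      using i(2,3) by (simp_all add: \<beta>_def)
    have mod2: "moderate (\<lambda>\<epsilon>. partial i (partial i (mderiv \<beta> (u \<epsilon>))) (y \<epsilon>))"
      if "moderate y" "abs_gen y \<in> U" for y
      using mod[OF that, of "\<alpha>(i := Suc (\<alpha> i))"] unfolding eq .
    show ?thesis
      unfolding eq
      by (rule partial_null_net[OF U sub _ _ _ null mod2 less.prems])
        (use smooth_on_mderiv_differentiable smooth in blast)+
  qed
qed


section \<open>Norms on compactly supported generalized functions\<close>

lemma foldr_partial_zero: "foldr partial is (\<lambda>_. 0) = (\<lambda>_. 0)"
  by (induction "is") (auto simp: partial_def fun_eq_iff)

lemma defines_gsf_zero: "defines_gsf (\<lambda>_. UNIV) (\<lambda>_ _. 0) U (\<lambda>_. 0)"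
proof -
  have "U \<subseteq> strongly_internal_set (\<lambda>_. UNIV)"
    unfolding strongly_internal_set_def by (auto intro: moderate_rep_gen abs_gen_rep_gen[symmetric])
  then show ?thesis
    by (simp add: defines_gsf_def smooth_on_def foldr_partial_zero mderiv_mindex_list
      moderate_const zero_gen_def)
qed

lemma zero_in_GD: "(\<lambda>_. 0) \<in> GD K U"
proof -
  have "(\<lambda>_. 0) \<in> gsf U" unfolding gsf_def using defines_gsf_zero by blast
  moreover have "null_net (\<lambda>\<epsilon>. mderiv \<alpha> (\<lambda>_. 0) (x \<epsilon>))" for \<alpha> :: "'a \<Rightarrow> nat" and x
    by (simp add: mderiv_mindex_list foldr_partial_zero null_net_zero)
  ultimately show ?thesis unfolding GD_def using defines_gsf_zero by blast
qed

text \<open>The substance is uniqueness in the definite description: any other net defining the zero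
  function has negligible derivatives at points of \<open>U\<close>.\<close>

lemma gderiv_zero:
  assumes "openin sharp_topology U" "p \<in> U"
  shows "gderiv U \<alpha> (\<lambda>_. 0) p = 0"
  unfolding gderiv_def
proof (rule the_equality)
  have "(0 :: real gen) = abs_gen (\<lambda>\<epsilon>. mderiv \<alpha> (\<lambda>_. 0) (rep_gen p \<epsilon>))"
    by (simp add: mderiv_mindex_list foldr_partial_zero zero_gen_def)
  then show "\<exists>\<Omega> u x. defines_gsf \<Omega> u U (\<lambda>_. 0) \<and> moderate x \<and> abs_gen x = p \<and>
      0 = abs_gen (\<lambda>\<epsilon>. mderiv \<alpha> (u \<epsilon>) (x \<epsilon>))"
    using defines_gsf_zero moderate_rep_gen abs_gen_rep_gen by blast
next
  fix y
  assume "\<exists>\<Omega> u x. defines_gsf \<Omega> u U (\<lambda>_. 0) \<and> moderate x \<and> abs_gen x = p \<and>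
      y = abs_gen (\<lambda>\<epsilon>. mderiv \<alpha> (u \<epsilon>) (x \<epsilon>))"
  then obtain \<Omega> u x where *: "defines_gsf \<Omega> u U (\<lambda>_. 0)" "moderate x" "abs_gen x = p"
      "y = abs_gen (\<lambda>\<epsilon>. mderiv \<alpha> (u \<epsilon>) (x \<epsilon>))" by blast
  have "null_net (\<lambda>\<epsilon>. mderiv \<alpha> (u \<epsilon>) (x \<epsilon>))"
    using mderiv_null_net[OF assms(1) *(1,2)] *(3) assms(2) by blast
  moreover have "moderate (\<lambda>\<epsilon>. mderiv \<alpha> (u \<epsilon>) (x \<epsilon>))"
    using * assms(2) unfolding defines_gsf_def by blast
  ultimately show "y = 0"
    unfolding *(4) zero_gen_def using moderate_const by (subst abs_gen_eq_iff) auto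
qed

text \<open>At order zero \<open>defines_gsf\<close> itself prescribes the value, so all defining
  nets agree.\<close>

lemma gderiv_zero_index:
  assumes "f \<in> gsf U" "p \<in> U"
  shows "gderiv U (\<lambda>_. 0) f p = f p"
  unfolding gderiv_def mderiv_zero_index
proof (rule the_equality)
  obtain \<Omega> u where u: "defines_gsf \<Omega> u U f" using assms(1) unfolding gsf_def by blast
  then have "f p = abs_gen (\<lambda>\<epsilon>. u \<epsilon> (rep_gen p \<epsilon>))"
    unfolding defines_gsf_def using assms(2) moderate_rep_gen[of p] abs_gen_rep_gen[of p] by metis
  with u show "\<exists>\<Omega> u x. defines_gsf \<Omega> u U f \<and> moderate x \<and> abs_gen x = p \<and> f p = abs_gen (\<lambda>\<epsilon>. u \<epsilon> (x \<epsilon>))"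
    using moderate_rep_gen[of p] abs_gen_rep_gen[of p] by blast
next
  fix y
  assume "\<exists>\<Omega> u x. defines_gsf \<Omega> u U f \<and> moderate x \<and> abs_gen x = p \<and> y = abs_gen (\<lambda>\<epsilon>. u \<epsilon> (x \<epsilon>))"
  then show "y = f p" using assms(2) unfolding defines_gsf_def by auto
qed

lemma gle_refl: "x \<le>\<^sub>g x"
  using gle_abs_genI[OF moderate_rep_gen moderate_rep_gen, of x x] by simp

lemma GD_norm_zero:
  fixes U :: "(real^'n::finite) gen set"
  assumes "openin sharp_topology U" "K \<noteq> {}" "K \<subseteq> U"
  shows "GD_norm K U m (\<lambda>_. 0) = 0"
proof -
  \<comment> \<open>Every point of \<open>K\<close> is extremal here. Existence is what guarantees
    that the points picked by \<open>SOME\<close> lie in \<open>U\<close>, where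
    \<open>gderiv_zero\<close> applies.\<close>
  have "\<exists>p. p \<in> K \<and> (\<forall>x\<in>K. gderiv U \<alpha> (\<lambda>_. 0) x \<le>\<^sub>g gderiv U \<alpha> (\<lambda>_. 0) p)"
      "\<exists>p. p \<in> K \<and> (\<forall>x\<in>K. gderiv U \<alpha> (\<lambda>_. 0) p \<le>\<^sub>g gderiv U \<alpha> (\<lambda>_. 0) x)" for \<alpha>
    using assms by (auto simp: gderiv_zero gle_refl subset_iff)
  from this[THEN someI_ex] have
    "max_point K (gderiv U \<alpha> (\<lambda>_. 0)) \<in> U" "min_point K (gderiv U \<alpha> (\<lambda>_. 0)) \<in> U" for \<alpha>
    unfolding max_point_def min_point_def using assms(3) by blast+
  then have "GD_norm K U m (\<lambda>_. 0) = gMax (\<Union>\<alpha>\<in>{\<alpha>::'n \<Rightarrow> nat. sum \<alpha> UNIV \<le> m}. {gabs (0::real gen), gabs (0::real gen)})"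
    unfolding GD_norm_def by (simp only: gderiv_zero[OF assms(1)])
  also have "(\<Union>\<alpha>\<in>{\<alpha>::'n \<Rightarrow> nat. sum \<alpha> UNIV \<le> m}. {gabs (0::real gen), gabs (0::real gen)}) = {0}"
  proof -
    have "gabs (0 :: real gen) = 0"
      by (simp add: zero_gen_def gabs_abs_gen moderate_const)
    moreover have "(\<lambda>_::'n. 0) \<in> {\<alpha>::'n \<Rightarrow> nat. sum \<alpha> UNIV \<le> m}" by simp
    then have "{\<alpha>::'n \<Rightarrow> nat. sum \<alpha> UNIV \<le> m} \<noteq> {}" by blast
    ultimately show ?thesis by (simp only: UN_constant insert_absorb2 if_False)
  qed
  finally show ?thesis by (simp add: gMax_def)
qed

text \<open>Maximisation takes place on each compact \<open>A \<epsilon>\<close> separately, and the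
  bound \<open>\<epsilon> powr - N\<close> makes the net of maximisers moderate. Some
  representatives of a point of \<open>K\<close> may leave \<open>A \<epsilon>\<close>, so the
  comparison is claimed for one suitable \<open>x'\<close>.\<close>

lemma functionally_compact_attains_sup:
  fixes u :: "real \<Rightarrow> 'a::real_normed_vector \<Rightarrow> real"
  assumes "functionally_compact K" "K \<noteq> {}"
    and cont: "\<And>\<epsilon>. \<epsilon> \<in> {0<..1} \<Longrightarrow> continuous_on UNIV (u \<epsilon>)"
  obtains M where "moderate M" "abs_gen M \<in> K"
    "\<And>x. x \<in> K \<Longrightarrow> \<exists>x'. moderate x' \<and> abs_gen x' = x \<and> (\<forall>\<^sub>F \<epsilon> in at_right 0. u \<epsilon> (x' \<epsilon>) \<le> u \<epsilon> (M \<epsilon>))"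
proof -
  obtain A and N :: real where A: "\<And>\<epsilon>. \<epsilon> \<in> {0<..1} \<Longrightarrow> compact (A \<epsilon>)"
      "\<forall>\<^sub>F \<epsilon> in at_right 0. \<forall>x\<in>A \<epsilon>. norm x \<le> \<epsilon> powr - N" "K = internal_set A"
    using assms(1) unfolding functionally_compact_def by blast
  have small: "\<forall>\<^sub>F \<epsilon>::real in at_right 0. \<epsilon> \<in> {0<..1}"
    using eventually_small[OF zero_less_one] by eventually_elim simp
  obtain x where "\<forall>\<^sub>F \<epsilon> in at_right 0. x \<epsilon> \<in> A \<epsilon>"
    using assms(2) A(3) unfolding internal_set_def by blast
  then have ne: "\<forall>\<^sub>F \<epsilon> in at_right 0. A \<epsilon> \<noteq> {}" by eventually_elim blast
  have "\<exists>M\<in>A \<epsilon>. \<forall>x\<in>A \<epsilon>. u \<epsilon> x \<le> u \<epsilon> M" if "\<epsilon> \<in> {0<..1}" "A \<epsilon> \<noteq> {}" for \<epsilon>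
    using A(1) cont that continuous_attains_sup continuous_on_subset by (metis subset_UNIV)
  then obtain M where M: "\<And>\<epsilon>. \<epsilon> \<in> {0<..1} \<Longrightarrow> A \<epsilon> \<noteq> {} \<Longrightarrow> M \<epsilon> \<in> A \<epsilon> \<and> (\<forall>x\<in>A \<epsilon>. u \<epsilon> x \<le> u \<epsilon> (M \<epsilon>))"
    by metis
  have M_in: "\<forall>\<^sub>F \<epsilon> in at_right 0. M \<epsilon> \<in> A \<epsilon>"
    using small ne by eventually_elim (use M in blast)
  have "\<forall>\<^sub>F \<epsilon> in at_right 0. norm (M \<epsilon>) \<le> norm (\<epsilon> powr - N)"
    using M_in A(2) by eventually_elim simp
  then have mod: "moderate M" by (rule moderate_bound[OF moderate_powr])
  show ?thesis
  proof
    show "moderate M" by fact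
    show "abs_gen M \<in> K" unfolding A(3) internal_set_def using mod M_in by blast
    fix x assume "x \<in> K"
    then obtain x' where x': "moderate x'" "x = abs_gen x'" "\<forall>\<^sub>F \<epsilon> in at_right 0. x' \<epsilon> \<in> A \<epsilon>"
      unfolding A(3) internal_set_def by blast
    have "\<forall>\<^sub>F \<epsilon> in at_right 0. u \<epsilon> (x' \<epsilon>) \<le> u \<epsilon> (M \<epsilon>)"
      using small ne x'(3) by eventually_elim (use M in blast)
    with x' show "\<exists>x'. moderate x' \<and> abs_gen x' = x \<and> (\<forall>\<^sub>F \<epsilon> in at_right 0. u \<epsilon> (x' \<epsilon>) \<le> u \<epsilon> (M \<epsilon>))" by blast
  qed
qed

text \<open>This gives meaning to the \<open>SOME\<close> in \<open>max_point\<close> and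
  \<open>min_point\<close> at order zero. As \<open>u\<close> yields the value of \<open>f\<close>
  on any representative, a comparison on one representative is enough; minima are maxima of
  \<open>- u\<close>.\<close>

lemma GD_extremal_points:
  assumes "f \<in> GD K U" "functionally_compact K" "K \<noteq> {}" "K \<subseteq> U"
  shows "\<exists>p. p \<in> K \<and> (\<forall>x\<in>K. f x \<le>\<^sub>g f p)" "\<exists>p. p \<in> K \<and> (\<forall>x\<in>K. f p \<le>\<^sub>g f x)"
proof -
  obtain u where u: "defines_gsf (\<lambda>_. UNIV) u U f" using assms(1) unfolding GD_def by blast
  have val: "f (abs_gen x) = abs_gen (\<lambda>\<epsilon>. u \<epsilon> (x \<epsilon>))" "moderate (\<lambda>\<epsilon>. u \<epsilon> (x \<epsilon>))"
    if "moderate x" "abs_gen x \<in> K" for x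
  proof -
    show "f (abs_gen x) = abs_gen (\<lambda>\<epsilon>. u \<epsilon> (x \<epsilon>))"
      using u assms(4) that unfolding defines_gsf_def by blast
    have "moderate (\<lambda>\<epsilon>. mderiv (\<lambda>_. 0) (u \<epsilon>) (x \<epsilon>))"
      using u assms(4) that unfolding defines_gsf_def by blast
    then show "moderate (\<lambda>\<epsilon>. u \<epsilon> (x \<epsilon>))" by simp
  qed
  have cont: "continuous_on UNIV (u \<epsilon>)" if "\<epsilon> \<in> {0<..1}" for \<epsilon>
  proof -
    have "smooth_on UNIV (u \<epsilon>)" using u that unfolding defines_gsf_def by blast
    then have "u \<epsilon> differentiable (at x)" for x
      using smooth_on_mderiv_differentiable(1)[of UNIV "u \<epsilon>" x "\<lambda>_. 0"] by simp
    then show ?thesis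
      by (simp add: continuous_at_imp_continuous_on differentiable_imp_continuous_within)
  qed
  then have cont': "continuous_on UNIV (\<lambda>x. - u \<epsilon> x)" if "\<epsilon> \<in> {0<..1}" for \<epsilon>
    using that by (intro continuous_on_minus)
  show "\<exists>p. p \<in> K \<and> (\<forall>x\<in>K. f x \<le>\<^sub>g f p)"
  proof (rule functionally_compact_attains_sup[OF assms(2,3), of u])
    fix M assume M: "moderate M" "abs_gen M \<in> K" "\<And>x. x \<in> K \<Longrightarrow>
        \<exists>x'. moderate x' \<and> abs_gen x' = x \<and> (\<forall>\<^sub>F \<epsilon> in at_right 0. u \<epsilon> (x' \<epsilon>) \<le> u \<epsilon> (M \<epsilon>))"
    have "f x \<le>\<^sub>g f (abs_gen M)" if "x \<in> K" for x
      using M(3)[OF that] that val M(1,2) by (metis gle_abs_genI)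
    with M show ?thesis by blast
  qed (rule cont)
  show "\<exists>p. p \<in> K \<and> (\<forall>x\<in>K. f p \<le>\<^sub>g f x)"
  proof (rule functionally_compact_attains_sup[OF assms(2,3), of "\<lambda>\<epsilon> x. - u \<epsilon> x"])
    fix M assume M: "moderate M" "abs_gen M \<in> K" "\<And>x. x \<in> K \<Longrightarrow>
        \<exists>x'. moderate x' \<and> abs_gen x' = x \<and> (\<forall>\<^sub>F \<epsilon> in at_right 0. - u \<epsilon> (x' \<epsilon>) \<le> - u \<epsilon> (M \<epsilon>))"
    have "f (abs_gen M) \<le>\<^sub>g f x" if "x \<in> K" for x
      using M(3)[OF that] that val M(1,2) unfolding neg_le_iff_le by (metis gle_abs_genI)
    with M show ?thesis by blast
  qed (rule cont')
qed

section \<open>From a bound on the norm to a bound on values\<close>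

lemma moderate_sum: "finite S \<Longrightarrow> (\<And>x. x \<in> S \<Longrightarrow> moderate (g x)) \<Longrightarrow> moderate (\<lambda>\<epsilon>. \<Sum>x\<in>S. g x \<epsilon>)"
  by (induction S rule: finite_induct) (simp_all add: moderate_const moderate_add)

text \<open>\<open>gMax\<close> is \<open>abs_gen\<close> of this net, and the order can be read on
  the net only once it is moderate. The sum of the absolute values dominates it.\<close>

lemma moderate_Max_rep_gen:
  assumes "finite S" "S \<noteq> {}"
  shows "moderate (\<lambda>\<epsilon>. Max ((\<lambda>x. rep_gen x \<epsilon>) ` S) :: real)"
proof (rule moderate_bound)
  show "moderate (\<lambda>\<epsilon>. \<Sum>x\<in>S. norm (rep_gen x \<epsilon>))"
    using assms(1) by (intro moderate_sum moderate_norm moderate_rep_gen)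
  have "norm (Max ((\<lambda>x. rep_gen x \<epsilon>) ` S)) \<le> norm (\<Sum>x\<in>S. norm (rep_gen x \<epsilon>))" for \<epsilon>
  proof -
    have "Max ((\<lambda>x. rep_gen x \<epsilon>) ` S) \<in> (\<lambda>x. rep_gen x \<epsilon>) ` S"
      using assms by (intro Max_in) auto
    then obtain x where "x \<in> S" "Max ((\<lambda>x. rep_gen x \<epsilon>) ` S) = rep_gen x \<epsilon>" by auto
    then have "norm (Max ((\<lambda>x. rep_gen x \<epsilon>) ` S)) \<le> (\<Sum>x\<in>S. norm (rep_gen x \<epsilon>))"
      using assms(1) member_le_sum[of x S "\<lambda>x. norm (rep_gen x \<epsilon>)"] by simp
    then show ?thesis by simp
  qed
  then show "\<forall>\<^sub>F \<epsilon> in at_right 0. norm (Max ((\<lambda>x. rep_gen x \<epsilon>) ` S)) \<le> norm (\<Sum>x\<in>S. norm (rep_gen x \<epsilon>))"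
    by simp
qed

lemma finite_mindices: "finite {\<alpha> :: 'n::finite \<Rightarrow> nat. sum \<alpha> UNIV \<le> m}"
proof (rule finite_subset)
  show "{\<alpha> :: 'n \<Rightarrow> nat. sum \<alpha> UNIV \<le> m} \<subseteq> PiE UNIV (\<lambda>_. {..m})"
  proof
    fix \<alpha> :: "'n \<Rightarrow> nat" assume "\<alpha> \<in> {\<alpha>. sum \<alpha> UNIV \<le> m}"
    moreover have "\<alpha> i \<le> sum \<alpha> UNIV" for i by (rule member_le_sum) auto
    ultimately have "\<alpha> i \<le> m" for i using order_trans by blast
    then show "\<alpha> \<in> PiE UNIV (\<lambda>_. {..m})" by (simp add: PiE_UNIV_domain)
  qed
  show "finite (PiE (UNIV :: 'n set) (\<lambda>_. {..m}))" by (intro finite_PiE) auto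
qed

text \<open>The index 0 puts the absolute values of \<open>f\<close> at its maximum and minimum over
  \<open>K\<close> into the set whose maximum is the norm, and \<open>f x\<close> lies between the
  two extremes. The bound is 2 and not 1 because passages between representatives cost up to
  \<epsilon> each.\<close>

lemma GD_norm_less_one_imp_bounded:
  fixes f :: "(real^'n::finite) gen \<Rightarrow> real gen"
  assumes f: "f \<in> GD K U" and K: "functionally_compact K" "K \<noteq> {}" "K \<subseteq> U"
    and less: "GD_norm K U m f <\<^sub>g \<rho>" "\<rho> <\<^sub>g 1"
    and x: "x \<in> K" and y: "moderate y" "f x = abs_gen y"
  shows "\<forall>\<^sub>F \<epsilon> in at_right 0. \<bar>y \<epsilon>\<bar> \<le> 2"
proof -
  define S where "S = (\<Union>\<alpha>\<in>{\<alpha>. sum \<alpha> UNIV \<le> m}.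
      {gabs (gderiv U \<alpha> f (max_point K (gderiv U \<alpha> f))),
       gabs (gderiv U \<alpha> f (min_point K (gderiv U \<alpha> f)))})"
  define N where "N \<epsilon> = Max ((\<lambda>x. rep_gen x \<epsilon>) ` S)" for \<epsilon>
  have S: "finite S" unfolding S_def by (intro finite_UN_I finite_mindices) auto
  have gd: "gderiv U (\<lambda>_. 0) f p = f p" if "p \<in> K" for p
    using f K(3) that unfolding GD_def by (intro gderiv_zero_index) auto
  define P where "P = max_point K (gderiv U (\<lambda>_. 0) f)"
  define Q where "Q = min_point K (gderiv U (\<lambda>_. 0) f)"
  have "\<exists>p. p \<in> K \<and> (\<forall>x\<in>K. gderiv U (\<lambda>_. 0) f x \<le>\<^sub>g gderiv U (\<lambda>_. 0) f p)"
      "\<exists>p. p \<in> K \<and> (\<forall>x\<in>K. gderiv U (\<lambda>_. 0) f p \<le>\<^sub>g gderiv U (\<lambda>_. 0) f x)"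
    using GD_extremal_points[OF f K] gd by auto
  from this[THEN someI_ex] x gd
  have P: "P \<in> K" "f x \<le>\<^sub>g f P" and Q: "Q \<in> K" "f Q \<le>\<^sub>g f x"
    unfolding P_def Q_def max_point_def min_point_def by auto
  have in_S: "gabs (f P) \<in> S" "gabs (f Q) \<in> S"
  proof -
    have "(\<lambda>_. 0) \<in> {\<alpha> :: 'n \<Rightarrow> nat. sum \<alpha> UNIV \<le> m}" by simp
    then have "gabs (gderiv U (\<lambda>_. 0) f P) \<in> S" "gabs (gderiv U (\<lambda>_. 0) f Q) \<in> S"
      unfolding S_def P_def Q_def by blast+
    then show "gabs (f P) \<in> S" "gabs (f Q) \<in> S" using gd P(1) Q(1) by simp_all
  qed
  then have N_mod: "moderate N"
    unfolding N_def using S by (intro moderate_Max_rep_gen) auto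
  have le_N: "\<forall>\<^sub>F \<epsilon> in at_right 0. \<bar>rep_gen p \<epsilon>\<bar> \<le> N \<epsilon> + \<epsilon> ^ 1" if "gabs p \<in> S" for p :: "real gen"
  proof -
    have "gabs p = abs_gen (\<lambda>\<epsilon>. norm (rep_gen p \<epsilon>))"
      using gabs_abs_gen[OF moderate_rep_gen, of p] by simp
    then have "null_net (\<lambda>\<epsilon>. rep_gen (gabs p) \<epsilon> - norm (rep_gen p \<epsilon>))"
      using null_net_rep_gen[OF moderate_norm[OF moderate_rep_gen[of p]]] by simp
    then have "\<forall>\<^sub>F \<epsilon> in at_right 0. norm (rep_gen (gabs p) \<epsilon> - norm (rep_gen p \<epsilon>)) \<le> \<epsilon> ^ 1"
      unfolding null_net_iff by (rule spec)
    then show ?thesis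
    proof eventually_elim
      case (elim \<epsilon>)
      have "rep_gen (gabs p) \<epsilon> \<le> N \<epsilon>" unfolding N_def using S that by (intro Max_ge) auto
      with elim show ?case by simp
    qed
  qed
  have "GD_norm K U m f = abs_gen N"
    unfolding GD_norm_def S_def[symmetric] gMax_def N_def ..
  then obtain q where "\<forall>\<^sub>F \<epsilon> in at_right 0. \<epsilon> ^ q \<le> rep_gen \<rho> \<epsilon> - N \<epsilon>"
    using less(1) gless_abs_gen_iff[OF N_mod moderate_rep_gen, of \<rho>] by auto
  moreover obtain r where "\<forall>\<^sub>F \<epsilon> in at_right 0. \<epsilon> ^ r \<le> 1 - rep_gen \<rho> \<epsilon>"
    using less(2) gless_abs_gen_iff[OF moderate_rep_gen moderate_const, of \<rho> 1] by (auto simp: one_gen_def)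
  moreover have "\<forall>\<^sub>F \<epsilon> in at_right 0. y \<epsilon> \<le> rep_gen (f P) \<epsilon> + \<epsilon> ^ 1"
    using gle_abs_genD[OF _ y(1) moderate_rep_gen, of "f P" 1] P(2) y(2) by simp
  moreover have "\<forall>\<^sub>F \<epsilon> in at_right 0. rep_gen (f Q) \<epsilon> \<le> y \<epsilon> + \<epsilon> ^ 1"
    using gle_abs_genD[OF _ moderate_rep_gen y(1), of "f Q" 1] Q(2) y(2) by simp
  moreover have "\<forall>\<^sub>F \<epsilon>::real in at_right 0. 0 < \<epsilon> \<and> \<epsilon> < 1/2" by (rule eventually_small) simp
  ultimately show ?thesis
    using le_N[OF in_S(1)] le_N[OF in_S(2)]
  proof eventually_elim
    case (elim \<epsilon>)
    then have "\<epsilon> ^ q > 0" "\<epsilon> ^ r > 0" by simp_all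
    with elim show ?case unfolding power_one_right by linarith
  qed
qed

text \<open>Scaling the fixed vector \<open>d\<close> is a continuous map on the Euclidean real line
  that sends 0 into \<open>V\<close>, so the preimage of \<open>V\<close> contains an interval
  around 0.\<close>

lemma hausdorff_tvs_absorbing:
  assumes "hausdorff_tvs \<sigma>" "openin \<sigma> V" "0 \<in> V" "d \<in> topspace \<sigma>"
  obtains r where "r > 0" "r *\<^sub>R d \<in> V"
proof -
  have "continuous_map euclideanreal (prod_topology euclideanreal \<sigma>) (\<lambda>r. (r, d))"
    using assms(4) by (intro continuous_map_pairedI) auto
  moreover have "continuous_map (prod_topology euclideanreal \<sigma>) \<sigma> (\<lambda>(r, f). r *\<^sub>R f)"
    using assms(1) unfolding hausdorff_tvs_def by blast
  ultimately have "continuous_map euclideanreal \<sigma> ((\<lambda>(r, f). r *\<^sub>R f) \<circ> (\<lambda>r. (r, d)))"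
    by (rule continuous_map_compose)
  then have "continuous_map euclideanreal \<sigma> (\<lambda>r. r *\<^sub>R d)" by (simp add: o_def)
  from openin_continuous_map_preimage[OF this assms(2)]
  have "open {r. r *\<^sub>R d \<in> V}" by simp
  moreover have "0 \<in> {r. r *\<^sub>R d \<in> V}" using assms(3) by simp
  ultimately obtain e where "e > 0" "ball 0 e \<subseteq> {r. r *\<^sub>R d \<in> V}"
    using open_contains_ball by blast
  moreover from \<open>e > 0\<close> have "e / 2 \<in> ball 0 e" by simp
  ultimately have "(e / 2) *\<^sub>R d \<in> V" by blast
  then show ?thesis using that \<open>e > 0\<close> half_gt_zero by blast
qed


section \<open>The Dirac delta\<close>

lemma colombeau_mollifier_derivative_bound:
  fixes \<mu> :: "real^'n::finite \<Rightarrow> real"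
  assumes "colombeau_mollifier \<mu>"
  shows "\<exists>c. \<forall>x. \<bar>mderiv \<alpha> \<mu> x\<bar> \<le> c"
proof -
  have "bounded (range (\<lambda>x. monomial (\<lambda>_. 0) x * mderiv \<alpha> \<mu> x))"
    using assms unfolding colombeau_mollifier_def schwartz_def by blast
  then show ?thesis unfolding bounded_iff monomial_def by auto
qed

lemma embedding_mollifier_smooth:
  assumes "embedding_mollifier \<psi> b" "\<epsilon> \<in> {0<..1}"
  shows "smooth_on UNIV (\<psi> \<epsilon>)"
  using assms
  unfolding embedding_mollifier_def colombeau_mollifier_def schwartz_def compact_mollifier_net_def
  by blast

text \<open>A common form for both kinds of mollifier: \<open>C\<close> is constant for a fixed
  Schwartz function and a multiple of a power of \<open>1 / \<epsilon>\<close> for a compactly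
  supported net.\<close>

lemma embedding_mollifier_derivative_bound:
  assumes "embedding_mollifier \<psi> b"
  obtains C where "moderate C" "\<forall>\<^sub>F \<epsilon> in at_right 0. \<forall>x. \<bar>mderiv \<alpha> (\<psi> \<epsilon>) x\<bar> \<le> C \<epsilon>"
proof -
  have "\<exists>(N::nat) c. \<forall>\<^sub>F \<epsilon> in at_right 0. \<forall>x. \<bar>mderiv \<alpha> (\<psi> \<epsilon>) x\<bar> \<le> c * (1 / \<epsilon>) ^ N"
    using assms unfolding embedding_mollifier_def
  proof (elim conjE disjE exE)
    fix \<mu> assume \<mu>: "colombeau_mollifier \<mu>" "\<psi> = (\<lambda>_. \<mu>)"
    then obtain c where c: "\<And>x. \<bar>mderiv \<alpha> \<mu> x\<bar> \<le> c"
      using colombeau_mollifier_derivative_bound by blast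
    show ?thesis
      by (rule exI[of _ 0], rule exI[of _ c]) (simp add: c \<mu>(2))
  qed (use compact_mollifier_net_def in blast)
  then obtain N c where "\<forall>\<^sub>F \<epsilon> in at_right 0. \<forall>x. \<bar>mderiv \<alpha> (\<psi> \<epsilon>) x\<bar> \<le> c * (1 / \<epsilon>) ^ N" by blast
  moreover have "moderate (\<lambda>\<epsilon>::real. c * (1 / \<epsilon>) ^ N)"
    by (intro moderate_mult moderate_const moderate_inverse_power)
  ultimately show ?thesis using that by blast
qed

text \<open>Serves to make values of the delta independent of the representative of the point: a
  moderate Lipschitz constant times a null distance is null.\<close>

lemma embedding_mollifier_lipschitz:
  fixes \<psi> :: "real \<Rightarrow> real^'n::finite \<Rightarrow> real"
  assumes "embedding_mollifier \<psi> b"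
  obtains L where "moderate L"
    "\<forall>\<^sub>F \<epsilon> in at_right 0. \<forall>x y. \<bar>\<psi> \<epsilon> x - \<psi> \<epsilon> y\<bar> \<le> L \<epsilon> * norm (x - y)"
proof -
  have "\<exists>C. moderate C \<and> (\<forall>\<^sub>F \<epsilon> in at_right 0. \<forall>x. \<bar>partial i (\<psi> \<epsilon>) x\<bar> \<le> C \<epsilon>)" for i :: 'n
    by (rule embedding_mollifier_derivative_bound[OF assms, of "(\<lambda>_. 0)(i := 1)"])
      (unfold mderiv_unit, blast)
  then have "\<forall>i::'n. \<exists>C. moderate C \<and> (\<forall>\<^sub>F \<epsilon> in at_right 0. \<forall>x. \<bar>partial i (\<psi> \<epsilon>) x\<bar> \<le> C \<epsilon>)"
    by blast
  from choice[OF this] obtain C where C: "\<And>i::'n. moderate (C i)"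
      "\<And>i. \<forall>\<^sub>F \<epsilon> in at_right 0. \<forall>x. \<bar>partial i (\<psi> \<epsilon>) x\<bar> \<le> C i \<epsilon>"
    by blast
  define L where "L \<epsilon> = real CARD('n) * (\<Sum>i\<in>UNIV. norm (C i \<epsilon>))" for \<epsilon>
  show ?thesis
  proof
    show "moderate L"
      unfolding L_def by (intro moderate_mult moderate_const moderate_sum moderate_norm C) simp
    have "\<forall>\<^sub>F \<epsilon> in at_right 0. \<forall>i x. \<bar>partial i (\<psi> \<epsilon>) x\<bar> \<le> C i \<epsilon>"
      by (rule eventually_all_finite) (rule C)
    with eventually_small[OF zero_less_one]
    show "\<forall>\<^sub>F \<epsilon> in at_right 0. \<forall>x y. \<bar>\<psi> \<epsilon> x - \<psi> \<epsilon> y\<bar> \<le> L \<epsilon> * norm (x - y)"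
    proof eventually_elim
      case (elim \<epsilon>)
      have diff: "\<psi> \<epsilon> differentiable (at x)" for x
        using smooth_on_mderiv_differentiable(1)[OF embedding_mollifier_smooth[OF assms], of \<epsilon> x "\<lambda>_. 0"]
          elim by simp
      have "\<bar>partial i (\<psi> \<epsilon>) x\<bar> \<le> (\<Sum>i\<in>UNIV. norm (C i \<epsilon>))" for i x
      proof -
        have "\<bar>partial i (\<psi> \<epsilon>) x\<bar> \<le> C i \<epsilon>" using elim(2) by blast
        also have "C i \<epsilon> \<le> norm (C i \<epsilon>)" by simp
        also have "\<dots> \<le> (\<Sum>i\<in>UNIV. norm (C i \<epsilon>))" by (rule member_le_sum) auto
        finally show ?thesis .
      qed
      then show ?case unfolding L_def by (intro allI partial_bound_imp_lipschitz diff)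
    qed
  qed
qed

text \<open>With V the volume of the unit ball, values below \<open>1 / (V + 1)\<close> would keep
  the integral at most \<open>V / (V + 1)\<close>, which is less than 1.\<close>

lemma ex_large_value_of_integral_one:
  fixes g :: "real^'n::finite \<Rightarrow> real"
  assumes "\<And>x. norm x > 1 \<Longrightarrow> g x = 0" "(LINT x|lborel. g x) = 1"
  shows "\<exists>y. norm y \<le> 1 \<and> 1 / (measure lborel (cball (0::real^'n) 1) + 1) \<le> \<bar>g y\<bar>"
proof (rule ccontr)
  define V where "V = measure lborel (cball (0::real^'n) 1)"
  have V: "V \<ge> 0" by (simp add: V_def)
  assume "\<nexists>y. norm y \<le> 1 \<and> 1 / (measure lborel (cball (0::real^'n) 1) + 1) \<le> \<bar>g y\<bar>"
  then have small: "\<bar>g y\<bar> < 1 / (V + 1)" if "norm y \<le> 1" for y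
    using that unfolding V_def by (meson not_le)
  have "\<bar>LINT x|lborel. g x\<bar> \<le> (LINT x|lborel. \<bar>g x\<bar>)" by (rule integral_abs_bound)
  also have "\<dots> \<le> (LINT x|lborel. indicator (cball (0::real^'n) 1) x * (1 / (V + 1)))"
  proof (rule integral_mono')
    show "integrable lborel (\<lambda>x. indicator (cball (0::real^'n) 1) x * (1 / (V + 1)))"
      by (intro integrable_mult_left integrable_real_indicator emeasure_lborel_cball_finite) auto
    show "\<bar>g x\<bar> \<le> indicator (cball 0 1) x * (1 / (V + 1))" for x
      using small[of x] assms(1)[of x] by (cases "norm x \<le> 1") (auto simp: indicator_def)
    show "0 \<le> indicator (cball 0 1) x * (1 / (V + 1))" for x :: "real^'n" using V by simp
  qed
  also have "\<dots> = V * (1 / (V + 1))" by (simp add: V_def)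
  also have "\<dots> < 1" using V by (simp add: field_simps)
  finally show False using assms(2) by simp
qed

text \<open>Integral 1 prevents the mollifiers from being uniformly small. A fixed Schwartz function
  has some nonzero value, which serves for all \<epsilon>; in the compact case the unit ball gives
  \<open>R = 1\<close> and its volume a common \<open>c\<close>.\<close>

lemma embedding_mollifier_large_values:
  fixes \<psi> :: "real \<Rightarrow> real^'n::finite \<Rightarrow> real"
  assumes "embedding_mollifier \<psi> b"
  obtains y R and c :: real where "c > 0" "\<And>\<epsilon>. \<epsilon> \<in> {0<..1} \<Longrightarrow> norm (y \<epsilon>) \<le> R \<and> c \<le> \<bar>\<psi> \<epsilon> (y \<epsilon>)\<bar>"
proof -
  have "\<exists>R. \<exists>c>0. \<forall>\<epsilon>\<in>{0<..1}. \<exists>y. norm y \<le> R \<and> c \<le> \<bar>\<psi> \<epsilon> y\<bar>"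
    using assms unfolding embedding_mollifier_def
  proof (elim conjE disjE exE)
    fix \<mu> assume \<mu>: "colombeau_mollifier \<mu>" "\<psi> = (\<lambda>_. \<mu>)"
    have "\<exists>y. \<mu> y \<noteq> 0"
    proof (rule ccontr)
      assume "\<nexists>y. \<mu> y \<noteq> 0"
      then have "\<mu> = (\<lambda>_. 0)" by auto
      then show False using \<mu>(1) unfolding colombeau_mollifier_def by simp
    qed
    then obtain y where "\<mu> y \<noteq> 0" by blast
    then show ?thesis
      unfolding \<mu>(2) by (intro exI[of _ "norm y"] exI[of _ "\<bar>\<mu> y\<bar>"]) auto
  next
    assume *: "compact_mollifier_net \<psi>"
    have "0 < 1 / (measure lborel (cball (0::real^'n) 1) + 1)"
      by (simp add: add_nonneg_pos)
    moreover have "\<exists>y. norm y \<le> 1 \<and> 1 / (measure lborel (cball (0::real^'n) 1) + 1) \<le> \<bar>\<psi> \<epsilon> y\<bar>"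
      if "\<epsilon> \<in> {0<..1}" for \<epsilon>
      using * that unfolding compact_mollifier_net_def by (intro ex_large_value_of_integral_one) auto
    ultimately show ?thesis by blast
  qed
  then show ?thesis using that by metis
qed

lemma embedding_scale_at_top:
  assumes "embedding_mollifier \<psi> b"
  shows "\<forall>\<^sub>F \<epsilon> in at_right 0. Z \<le> b \<epsilon>"
proof -
  obtain a where a: "a > 0" "\<forall>\<^sub>F \<epsilon> in at_right 0. \<epsilon> powr - a \<le> b \<epsilon>"
    using assms unfolding embedding_mollifier_def by blast
  \<comment> \<open>The maximum with 1 makes \<open>z\<close> positive, so that
    \<open>z powr (- (1 / a))\<close> is the point at which \<open>\<epsilon> powr - a\<close>
    equals \<open>z\<close>.\<close>
  define z where "z = max Z 1"
  have "z powr (- (1 / a)) > 0" by (simp add: z_def)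
  from a(2) eventually_small[OF this] show ?thesis
  proof eventually_elim
    case (elim \<epsilon>)
    have "Z \<le> z" by (simp add: z_def)
    also have "z = (z powr (- (1 / a))) powr - a"
      using a(1) by (simp add: powr_powr z_def)
    also have "\<dots> \<le> \<epsilon> powr - a"
      using elim a(1) by (intro powr_mono2') auto
    finally show ?case using elim by simp
  qed
qed

lemma mollify_delta: "mollify \<psi> b (\<lambda>\<phi>. \<phi> 0) \<epsilon> (x :: real^'n::finite) = b \<epsilon> ^ CARD('n) * \<psi> \<epsilon> (b \<epsilon> *\<^sub>R x)"
  by (simp add: mollify_def)

lemma moderate_power: "moderate x \<Longrightarrow> moderate (\<lambda>\<epsilon>. x \<epsilon> ^ k)" for x :: "real \<Rightarrow> 'a::real_normed_field"
  by (induction k) (simp_all add: moderate_const moderate_mult)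

text \<open>\<open>dirac\<close> evaluates at the unspecified representative
  \<open>rep_gen (abs_gen x)\<close>; the Lipschitz estimate shows that \<open>x\<close> itself
  gives the same class.\<close>

lemma dirac_abs_gen:
  fixes \<psi> :: "real \<Rightarrow> real^'n::finite \<Rightarrow> real"
  assumes "embedding_mollifier \<psi> b" "moderate x"
  shows "moderate (\<lambda>\<epsilon>. mollify \<psi> b (\<lambda>\<phi>. \<phi> 0) \<epsilon> (x \<epsilon>))"
    "abs_gen x \<in> X \<Longrightarrow> dirac \<psi> b X (abs_gen x) = abs_gen (\<lambda>\<epsilon>. mollify \<psi> b (\<lambda>\<phi>. \<phi> 0) \<epsilon> (x \<epsilon>))"
proof -
  let ?v = "mollify \<psi> b (\<lambda>\<phi>. \<phi> 0)"
  have b: "moderate b" using assms(1) unfolding embedding_mollifier_def by blast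
  obtain C where C: "moderate C" "\<forall>\<^sub>F \<epsilon> in at_right 0. \<forall>x. \<bar>mderiv (\<lambda>_. 0) (\<psi> \<epsilon>) x\<bar> \<le> C \<epsilon>"
    using embedding_mollifier_derivative_bound[OF assms(1)] by blast
  have mod: "moderate (\<lambda>\<epsilon>. ?v \<epsilon> (x \<epsilon>))" if "moderate x" for x
  proof -
    have "moderate (\<lambda>\<epsilon>. \<psi> \<epsilon> (b \<epsilon> *\<^sub>R x \<epsilon>))"
    proof (rule moderate_bound[OF C(1)])
      show "\<forall>\<^sub>F \<epsilon> in at_right 0. norm (\<psi> \<epsilon> (b \<epsilon> *\<^sub>R x \<epsilon>)) \<le> norm (C \<epsilon>)"
        using C(2) by eventually_elim (auto intro: order_trans)
    qed
    then show ?thesis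
      unfolding mollify_delta by (intro moderate_mult moderate_power b)
  qed
  obtain L where L: "moderate L"
      "\<forall>\<^sub>F \<epsilon> in at_right 0. \<forall>x y. \<bar>\<psi> \<epsilon> x - \<psi> \<epsilon> y\<bar> \<le> L \<epsilon> * norm (x - y)"
    using embedding_mollifier_lipschitz[OF assms(1)] by blast
  let ?x' = "rep_gen (abs_gen x)"
  \<comment> \<open>The power of \<open>b \<epsilon>\<close> is the normalising factor of the scaled
    mollifier; the last \<open>b \<epsilon>\<close> comes from the scaling of its argument.\<close>
  define M where "M \<epsilon> = b \<epsilon> ^ CARD('n) * L \<epsilon> * b \<epsilon>" for \<epsilon>
  have "moderate M" unfolding M_def by (intro moderate_mult moderate_power b L)
  moreover have "null_net (\<lambda>\<epsilon>. norm (?x' \<epsilon> - x \<epsilon>))"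
    using null_net_rep_gen[OF assms(2)] by (simp add: null_net_def)
  ultimately have "null_net (\<lambda>\<epsilon>. M \<epsilon> * norm (?x' \<epsilon> - x \<epsilon>))" by (rule null_net_mult)
  then have "null_net (\<lambda>\<epsilon>. ?v \<epsilon> (?x' \<epsilon>) - ?v \<epsilon> (x \<epsilon>))"
  proof (rule null_net_bound)
    show "\<forall>\<^sub>F \<epsilon> in at_right 0. norm (?v \<epsilon> (?x' \<epsilon>) - ?v \<epsilon> (x \<epsilon>)) \<le> norm (M \<epsilon> * norm (?x' \<epsilon> - x \<epsilon>))"
      using L(2)
    proof eventually_elim
      case (elim \<epsilon>)
      have "norm (?v \<epsilon> (?x' \<epsilon>) - ?v \<epsilon> (x \<epsilon>))
          = \<bar>b \<epsilon> ^ CARD('n)\<bar> * \<bar>\<psi> \<epsilon> (b \<epsilon> *\<^sub>R ?x' \<epsilon>) - \<psi> \<epsilon> (b \<epsilon> *\<^sub>R x \<epsilon>)\<bar>"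
        unfolding mollify_delta by (simp add: abs_mult[symmetric] right_diff_distrib)
      also have "\<dots> \<le> \<bar>b \<epsilon> ^ CARD('n)\<bar> * (L \<epsilon> * norm (b \<epsilon> *\<^sub>R ?x' \<epsilon> - b \<epsilon> *\<^sub>R x \<epsilon>))"
        using elim by (intro mult_left_mono) auto
      also have "norm (b \<epsilon> *\<^sub>R ?x' \<epsilon> - b \<epsilon> *\<^sub>R x \<epsilon>) = \<bar>b \<epsilon>\<bar> * norm (?x' \<epsilon> - x \<epsilon>)"
        by (simp add: scaleR_diff_right[symmetric])
      also have "\<bar>b \<epsilon> ^ CARD('n)\<bar> * (L \<epsilon> * (\<bar>b \<epsilon>\<bar> * norm (?x' \<epsilon> - x \<epsilon>)))
          \<le> \<bar>b \<epsilon> ^ CARD('n)\<bar> * (\<bar>L \<epsilon>\<bar> * (\<bar>b \<epsilon>\<bar> * norm (?x' \<epsilon> - x \<epsilon>)))"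
        by (intro mult_left_mono mult_right_mono) auto
      also have "\<dots> = norm (M \<epsilon> * norm (?x' \<epsilon> - x \<epsilon>))"
        by (simp add: M_def abs_mult mult_ac)
      finally show ?case .
    qed
  qed
  then have "abs_gen (\<lambda>\<epsilon>. ?v \<epsilon> (?x' \<epsilon>)) = abs_gen (\<lambda>\<epsilon>. ?v \<epsilon> (x \<epsilon>))"
    using abs_gen_eq_iff mod[OF moderate_rep_gen] mod[OF assms(2)] by blast
  then show "dirac \<psi> b X (abs_gen x) = abs_gen (\<lambda>\<epsilon>. ?v \<epsilon> (x \<epsilon>))" if "abs_gen x \<in> X"
    using that by (simp add: dirac_def gsf_of_def)
  show "moderate (\<lambda>\<epsilon>. ?v \<epsilon> (x \<epsilon>))" using mod assms(2) .
qed

lemma dirac_infinite_point: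
  fixes \<psi> :: "real \<Rightarrow> real^'n::finite \<Rightarrow> real"
  assumes "embedding_mollifier \<psi> b"
  obtains x where "moderate x" "\<And>d. d > 0 \<Longrightarrow> \<forall>\<^sub>F \<epsilon> in at_right 0. norm (x \<epsilon>) \<le> d"
    "\<And>Z. \<forall>\<^sub>F \<epsilon> in at_right 0. Z \<le> \<bar>mollify \<psi> b (\<lambda>\<phi>. \<phi> 0) \<epsilon> (x \<epsilon>)\<bar>"
proof -
  obtain y R and c :: real where c: "c > 0"
    and y: "\<And>\<epsilon>. \<epsilon> \<in> {0<..1} \<Longrightarrow> norm (y \<epsilon>) \<le> R \<and> c \<le> \<bar>\<psi> \<epsilon> (y \<epsilon>)\<bar>"
    by (rule embedding_mollifier_large_values[OF assms], rule that)
  \<comment> \<open>Dividing by \<open>b \<epsilon>\<close> undoes the scaling of the argument, so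
    the mollifier is evaluated at \<open>y \<epsilon>\<close>, while \<open>x\<close> tends to 0
    because \<open>y\<close> is bounded.\<close>
  define x where "x \<epsilon> = inverse (b \<epsilon>) *\<^sub>R y \<epsilon>" for \<epsilon>
  have lim: "\<forall>\<^sub>F \<epsilon> in at_right 0. norm (x \<epsilon>) \<le> d" if "d > 0" for d
    using embedding_scale_at_top[OF assms, of "max 1 (R / d)"] eventually_small[OF zero_less_one]
  proof eventually_elim
    case (elim \<epsilon>)
    then have "norm (y \<epsilon>) \<le> R" "R / d \<le> b \<epsilon>" "b \<epsilon> > 0" using y[of \<epsilon>] by auto
    then have "norm (y \<epsilon>) \<le> d * b \<epsilon>" using that by (auto simp: field_simps)
    then show ?case using \<open>b \<epsilon> > 0\<close> by (simp add: x_def field_simps)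
  qed
  show ?thesis
  proof
    show "moderate x"
      by (rule moderate_bound[OF moderate_const[of "1::real"]]) (use lim[of 1] in simp)
    show "\<forall>\<^sub>F \<epsilon> in at_right 0. Z \<le> \<bar>mollify \<psi> b (\<lambda>\<phi>. \<phi> 0) \<epsilon> (x \<epsilon>)\<bar>" for Z
      \<comment> \<open>A scale of at least 1 gives
        \<open>b \<epsilon> \<le> b \<epsilon> ^ CARD('n)\<close>, so the lower bound
        \<open>b \<epsilon> * c\<close> holds in every dimension.\<close>
      using embedding_scale_at_top[OF assms, of "max 1 (Z / c)"] eventually_small[OF zero_less_one]
    proof eventually_elim
      case (elim \<epsilon>)
      then have *: "c \<le> \<bar>\<psi> \<epsilon> (y \<epsilon>)\<bar>" "Z / c \<le> b \<epsilon>" "b \<epsilon> \<ge> 1" using y[of \<epsilon>] by auto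
      have "Z \<le> b \<epsilon> * c" using *(2) c by (simp add: field_simps)
      also have "\<dots> \<le> b \<epsilon> ^ CARD('n) * \<bar>\<psi> \<epsilon> (y \<epsilon>)\<bar>"
        using * c self_le_power[OF *(3), of "CARD('n)"] by (intro mult_mono) auto
      also have "\<dots> = \<bar>mollify \<psi> b (\<lambda>\<phi>. \<phi> 0) \<epsilon> (x \<epsilon>)\<bar>"
        using *(3) by (simp add: mollify_delta x_def abs_mult)
      finally show ?case .
    qed
  qed (rule lim)
qed


section \<open>Functionally compact sets and supports\<close>

text \<open>A nearest point of \<open>A \<epsilon>\<close>, which exists for a closed nonempty set,
  provides another representative of the same class.\<close>

lemma mem_internal_set_closed:
  fixes x :: "real \<Rightarrow> 'a::euclidean_space"
  assumes "moderate x" "\<forall>\<^sub>F \<epsilon> in at_right 0. closed (A \<epsilon>) \<and> A \<epsilon> \<noteq> {}"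
    and "null_net (\<lambda>\<epsilon>. infdist (x \<epsilon>) (A \<epsilon>))"
  shows "abs_gen x \<in> internal_set A"
proof -
  have "\<exists>p. closed (A \<epsilon>) \<and> A \<epsilon> \<noteq> {} \<longrightarrow> p \<in> A \<epsilon> \<and> infdist (x \<epsilon>) (A \<epsilon>) = dist (x \<epsilon>) p" for \<epsilon>
    using infdist_attains_inf by metis
  then obtain p where p: "\<And>\<epsilon>. closed (A \<epsilon>) \<and> A \<epsilon> \<noteq> {} \<Longrightarrow>
      p \<epsilon> \<in> A \<epsilon> \<and> infdist (x \<epsilon>) (A \<epsilon>) = dist (x \<epsilon>) (p \<epsilon>)" by metis
  have p_in: "\<forall>\<^sub>F \<epsilon> in at_right 0. p \<epsilon> \<in> A \<epsilon>"
    using assms(2) by eventually_elim (use p in blast)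
  have "null_net (\<lambda>\<epsilon>. p \<epsilon> - x \<epsilon>)"
  proof (rule null_net_bound[OF assms(3)])
    show "\<forall>\<^sub>F \<epsilon> in at_right 0. norm (p \<epsilon> - x \<epsilon>) \<le> norm (infdist (x \<epsilon>) (A \<epsilon>))"
      using assms(2) by eventually_elim (use p in \<open>simp add: dist_norm norm_minus_commute\<close>)
  qed
  moreover from this have "moderate p" by (rule moderate_cong_null[OF assms(1)])
  ultimately have "abs_gen x = abs_gen p" "moderate p"
    using abs_gen_eq_iff assms(1) null_net_diff_commute by blast+
  with p_in show ?thesis unfolding internal_set_def by blast
qed

text \<open>If \<open>x\<close> kept a distance \<open>\<epsilon>\<^sup>q\<close> from \<open>K\<close> for arbitrarily small \<open>\<epsilon>\<close>, then moving it far away for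
  all other \<open>\<epsilon>\<close> would give a point of \<open>ext_set K\<close> at which \<open>f\<close> does not vanish.\<close>

lemma GD_nonvanishing_point_mem:
  fixes K :: "(real^'n::finite) gen set"
  assumes f: "f \<in> GD K UNIV" and K: "functionally_compact K" "K \<noteq> {}"
    and x: "moderate x" and w: "moderate w" "f (abs_gen x) = abs_gen w"
      "\<forall>\<^sub>F \<epsilon> in at_right 0. 1 \<le> \<bar>w \<epsilon>\<bar>"
  shows "abs_gen x \<in> K"
proof -
  obtain A and N :: real where A: "\<And>\<epsilon>. \<epsilon> \<in> {0<..1} \<Longrightarrow> compact (A \<epsilon>)"
      "\<forall>\<^sub>F \<epsilon> in at_right 0. \<forall>x\<in>A \<epsilon>. norm x \<le> \<epsilon> powr - N" "K = internal_set A"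
    using K(1) unfolding functionally_compact_def by blast
  obtain x0 where "\<forall>\<^sub>F \<epsilon> in at_right 0. x0 \<epsilon> \<in> A \<epsilon>"
    using K(2) A(3) unfolding internal_set_def by blast
  then have A': "\<forall>\<^sub>F \<epsilon> in at_right 0. closed (A \<epsilon>) \<and> A \<epsilon> \<noteq> {}"
    using eventually_small[OF zero_less_one]
    by eventually_elim (metis A(1) compact_imp_closed empty_iff greaterThanAtMost_iff less_imp_le)
  obtain u where u: "defines_gsf (\<lambda>_. UNIV) u UNIV f"
      and u_ext: "\<And>\<alpha> x. moderate x \<Longrightarrow> abs_gen x \<in> ext_set K \<Longrightarrow> null_net (\<lambda>\<epsilon>. mderiv \<alpha> (u \<epsilon>) (x \<epsilon>))"
    using f unfolding GD_def by blast
  have "moderate (\<lambda>\<epsilon>. mderiv (\<lambda>_. 0) (u \<epsilon>) (x \<epsilon>))" "f (abs_gen x) = abs_gen (\<lambda>\<epsilon>. u \<epsilon> (x \<epsilon>))"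
    using u x unfolding defines_gsf_def by blast+
  then have "null_net (\<lambda>\<epsilon>. u \<epsilon> (x \<epsilon>) - w \<epsilon>)"
    using w(1,2) abs_gen_eq_iff[of "\<lambda>\<epsilon>. u \<epsilon> (x \<epsilon>)" w] by simp
  then have u_w: "\<forall>\<^sub>F \<epsilon> in at_right 0. norm (u \<epsilon> (x \<epsilon>) - w \<epsilon>) \<le> \<epsilon> ^ 1"
    unfolding null_net_iff by (rule spec)
  have "\<forall>\<^sub>F \<epsilon> in at_right 0. norm (infdist (x \<epsilon>) (A \<epsilon>)) \<le> \<epsilon> ^ q" for q
  proof -
    \<comment> \<open>The length \<open>\<epsilon> powr - N + 1\<close> exceeds every norm in
      \<open>A \<epsilon>\<close> by at least 1, hence by at least \<open>\<epsilon> ^ q\<close>;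
      the direction is arbitrary.\<close>
    define z :: "real \<Rightarrow> real^'n" where "z \<epsilon> = (\<epsilon> powr - N + 1) *\<^sub>R axis undefined 1" for \<epsilon>
    define y where "y \<epsilon> = (if infdist (x \<epsilon>) (A \<epsilon>) \<le> \<epsilon> ^ q then z \<epsilon> else x \<epsilon>)" for \<epsilon>
    have "moderate (\<lambda>\<epsilon>. norm (x \<epsilon>) + (\<epsilon> powr - N + 1))"
      by (intro moderate_add moderate_norm moderate_const moderate_powr x)
    then have y_mod: "moderate y"
      by (rule moderate_bound) (auto simp: y_def z_def)
    have "abs_gen y \<in> ext_set K"
      unfolding ext_set_def
    proof (intro CollectI ballI)
      fix a assume "a \<in> K"
      then obtain a' where a': "moderate a'" "a = abs_gen a'" "\<forall>\<^sub>F \<epsilon> in at_right 0. a' \<epsilon> \<in> A \<epsilon>"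
        unfolding A(3) internal_set_def by blast
      have "\<forall>\<^sub>F \<epsilon> in at_right 0. \<epsilon> ^ q \<le> norm (y \<epsilon> - a' \<epsilon>) - 0"
        using a'(3) A(2) eventually_small[OF zero_less_one]
      proof eventually_elim
        case (elim \<epsilon>)
        show ?case
        proof (cases "infdist (x \<epsilon>) (A \<epsilon>) \<le> \<epsilon> ^ q")
          case True
          have "\<epsilon> ^ q \<le> 1" using elim by (simp add: power_le_one)
          moreover have "norm (z \<epsilon>) = \<epsilon> powr - N + 1" by (simp add: z_def)
          moreover have "norm (a' \<epsilon>) \<le> \<epsilon> powr - N" using elim by blast
          moreover have "norm (z \<epsilon>) - norm (a' \<epsilon>) \<le> norm (z \<epsilon> - a' \<epsilon>)" by (rule norm_triangle_ineq2)
          ultimately show ?thesis using True by (simp add: y_def)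
        next
          case False
          then show ?thesis using infdist_le[OF elim(1), of "x \<epsilon>"] by (simp add: y_def dist_norm)
        qed
      qed
      then have "abs_gen (\<lambda>_. 0) <\<^sub>g abs_gen (\<lambda>\<epsilon>. norm (y \<epsilon> - a' \<epsilon>))"
        using gless_abs_gen_iff[OF moderate_const moderate_norm[OF moderate_diff[OF y_mod a'(1)]]] by blast
      then show "0 <\<^sub>g gabs (abs_gen y - a)"
        using y_mod a'(1) by (simp add: a'(2) abs_gen_diff gabs_abs_gen moderate_diff zero_gen_def)
    qed
    from u_ext[OF y_mod this, of "\<lambda>_. 0"] have "\<forall>\<^sub>F \<epsilon> in at_right 0. norm (u \<epsilon> (y \<epsilon>)) \<le> \<epsilon> ^ 1"
      unfolding null_net_iff mderiv_zero_index by (rule spec)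
    moreover have "\<forall>\<^sub>F \<epsilon>::real in at_right 0. 0 < \<epsilon> \<and> \<epsilon> < 1/2" by (rule eventually_small) simp
    ultimately show ?thesis
      using u_w w(3)
    proof eventually_elim
      case (elim \<epsilon>)
      show ?case
      proof (rule ccontr)
        \<comment> \<open>At such an \<epsilon> the nets \<open>y\<close> and \<open>x\<close>
          agree, so \<open>u \<epsilon> (x \<epsilon>)\<close> has size at most \<epsilon> and yet
          lies within \<epsilon> of \<open>w \<epsilon>\<close>, whose size is at least 1. This is
          impossible below 1/2.\<close>
        assume "\<not> ?case"
        then have "y \<epsilon> = x \<epsilon>" by (simp add: y_def infdist_nonneg)
        with elim(1) have "\<bar>u \<epsilon> (x \<epsilon>)\<bar> \<le> \<epsilon>" by simp
        with elim show False unfolding real_norm_def power_one_right by linarith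
      qed
    qed
  qed
  then have "null_net (\<lambda>\<epsilon>. infdist (x \<epsilon>) (A \<epsilon>))" unfolding null_net_iff by blast
  then show ?thesis unfolding A(3) by (intro mem_internal_set_closed x A')
qed

text \<open>Points of a closure are approximated by points of the set within a positive null net,
  which leaves the class unchanged. This lets the sets
  \<open>{x \<in> \<Omega>. norm x \<le> J \<epsilon>}\<close>, in general not closed, be replaced
  by compact ones.\<close>

lemma internal_set_closure:
  fixes A :: "real \<Rightarrow> 'a::real_normed_vector set"
  shows "internal_set (\<lambda>\<epsilon>. closure (A \<epsilon>)) = internal_set A"
proof
  show "internal_set A \<subseteq> internal_set (\<lambda>\<epsilon>. closure (A \<epsilon>))"
    unfolding internal_set_def using closure_subset by (blast intro: eventually_mono)
  show "internal_set (\<lambda>\<epsilon>. closure (A \<epsilon>)) \<subseteq> internal_set A"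
  proof
    fix p assume "p \<in> internal_set (\<lambda>\<epsilon>. closure (A \<epsilon>))"
    then obtain x where x: "p = abs_gen x" "moderate x" "\<forall>\<^sub>F \<epsilon> in at_right 0. x \<epsilon> \<in> closure (A \<epsilon>)"
      unfolding internal_set_def by blast
    \<comment> \<open>The exponent grows beyond any fixed \<open>m\<close>, so the net is null, yet
      it is positive for every \<epsilon> > 0, as a radius in \<open>closure_approachable\<close>
      must be.\<close>
    define n :: "real \<Rightarrow> real" where "n \<epsilon> = \<epsilon> ^ nat \<lfloor>1 / \<epsilon>\<rfloor>" for \<epsilon>
    have "null_net n"
      unfolding null_net_iff
    proof
      fix m
      have "1 / (real m + 1) > 0" by simp
      from eventually_small[OF this] show "\<forall>\<^sub>F \<epsilon> in at_right 0. norm (n \<epsilon>) \<le> \<epsilon> ^ m"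
      proof eventually_elim
        case (elim \<epsilon>)
        then have "real m + 1 < 1 / \<epsilon>" by (simp add: field_simps)
        then have "m \<le> nat \<lfloor>1 / \<epsilon>\<rfloor>" by linarith
        moreover have "\<epsilon> \<le> 1" using elim by (simp add: field_simps) (smt (verit) mult_nonneg_nonneg of_nat_0_le_iff)
        ultimately show ?case using elim by (simp add: n_def power_decreasing)
      qed
    qed
    have "\<exists>y. 0 < \<epsilon> \<and> x \<epsilon> \<in> closure (A \<epsilon>) \<longrightarrow> y \<in> A \<epsilon> \<and> dist y (x \<epsilon>) < n \<epsilon>" for \<epsilon>
    proof (cases "0 < \<epsilon>")
      case True
      then have "n \<epsilon> > 0" by (simp add: n_def)
      then show ?thesis unfolding closure_approachable by blast
    qed simp
    then obtain y where y: "\<And>\<epsilon>. 0 < \<epsilon> \<and> x \<epsilon> \<in> closure (A \<epsilon>) \<Longrightarrow> y \<epsilon> \<in> A \<epsilon> \<and> dist (y \<epsilon>) (x \<epsilon>) < n \<epsilon>"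
      by metis
    have y': "\<forall>\<^sub>F \<epsilon> in at_right 0. y \<epsilon> \<in> A \<epsilon>"
      using x(3) eventually_small[OF zero_less_one] by eventually_elim (use y in blast)
    have "null_net (\<lambda>\<epsilon>. y \<epsilon> - x \<epsilon>)"
    proof (rule null_net_bound[OF \<open>null_net n\<close>])
      show "\<forall>\<^sub>F \<epsilon> in at_right 0. norm (y \<epsilon> - x \<epsilon>) \<le> norm (n \<epsilon>)"
        using x(3) eventually_small[OF zero_less_one]
      proof eventually_elim
        case (elim \<epsilon>)
        then have "dist (y \<epsilon>) (x \<epsilon>) < n \<epsilon>" using y by blast
        then show ?case by (simp add: dist_norm)
      qed
    qed
    moreover from this have "moderate y" by (rule moderate_cong_null[OF x(2)])
    ultimately have "abs_gen x = abs_gen y" "moderate y"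
      using abs_gen_eq_iff x(2) null_net_diff_commute by blast+
    with y' x(1) show "p \<in> internal_set A" unfolding internal_set_def by blast
  qed
qed

lemma functionally_compact_exhaustion:
  fixes \<Omega> :: "'a::euclidean_space set"
  assumes "moderate J"
  shows "functionally_compact (internal_set (\<lambda>\<epsilon>. {x \<in> \<Omega>. norm x \<le> J \<epsilon>}))"
proof -
  let ?A = "\<lambda>\<epsilon>. {x \<in> \<Omega>. norm x \<le> J \<epsilon>}"
  have sub: "closure (?A \<epsilon>) \<subseteq> cball 0 (J \<epsilon>)" for \<epsilon>
    by (rule closure_minimal) auto
  obtain N where N: "\<forall>\<^sub>F \<epsilon> in at_right 0. norm (J \<epsilon>) \<le> (1 / \<epsilon>) ^ N"
    using assms moderate_iff by blast
  \<comment> \<open>The exponent is \<open>Suc N\<close> because \<open>functionally_compact\<close>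
    requires a strictly positive one.\<close>
  have "\<forall>\<^sub>F \<epsilon> in at_right 0. \<forall>x\<in>closure (?A \<epsilon>). norm x \<le> \<epsilon> powr - (real (Suc N))"
    using N eventually_small[OF zero_less_one]
  proof eventually_elim
    case (elim \<epsilon>)
    have "(1 / \<epsilon>) ^ N = \<epsilon> powr - real N"
      using elim by (simp add: powr_minus powr_realpow power_one_over inverse_eq_divide)
    also have "\<dots> \<le> \<epsilon> powr - real (Suc N)"
      using elim by (intro powr_mono') auto
    finally show ?case using elim sub[of \<epsilon>] by force
  qed
  moreover have "compact (closure (?A \<epsilon>))" for \<epsilon>
    using bounded_subset[OF bounded_cball sub] by (simp add: compact_eq_bounded_closed)
  ultimately show ?thesis
    unfolding functionally_compact_def
    by (intro exI[of _ "\<lambda>\<epsilon>. closure (?A \<epsilon>)"] exI[of _ "real (Suc N)"]) (simp add: internal_set_closure)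
qed

section \<open>Zero lies in the ball, positive multiples of the delta do not\<close>

lemma zero_gless_one: "0 <\<^sub>g 1"
proof -
  have "\<forall>\<^sub>F \<epsilon>::real in at_right 0. \<epsilon> ^ 0 \<le> 1 - 0" by simp
  then show ?thesis
    unfolding zero_gen_def one_gen_def
    by (subst gless_abs_gen_iff) (blast intro: moderate_const)+
qed

text \<open>\<open>colombeau_ball\<close> measures extensions on the whole space, and
  \<open>zero_in_GD_ball\<close> asks for a sharply open domain there.\<close>

lemma openin_sharp_topology_UNIV: "openin sharp_topology UNIV"
proof -
  have "y \<in> topspace sharp_topology" for y :: "'a gen"
  proof -
    have "gabs (y - y) <\<^sub>g 1"
      using zero_gless_one by (simp add: zero_gen_def gabs_abs_gen moderate_const)
    then show ?thesis
      unfolding sharp_topology_def topology_generated_by_topspace using zero_gless_one by blast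
  qed
  then have "topspace (sharp_topology :: 'a gen topology) = UNIV" by blast
  then show ?thesis by (metis openin_topspace)
qed

lemma zero_in_GD_ball:
  assumes "openin sharp_topology U" "K \<noteq> {}" "K \<subseteq> U" "0 <\<^sub>g \<rho>"
  shows "0 \<in> GD_ball K U m \<rho>"
  unfolding zero_fun_def GD_ball_def using assms by (simp add: zero_in_GD GD_norm_zero)

text \<open>Only the value at one infinite point of \<open>K\<close> is prescribed. This covers both
  a multiple of the delta on \<open>U\<close> and an extension of such a multiple with unknown
  values off the compactly supported points.\<close>

lemma scaled_dirac_not_in_GD_ball:
  fixes \<psi> :: "real \<Rightarrow> real^'n::finite \<Rightarrow> real"
  assumes \<psi>: "embedding_mollifier \<psi> b" and K: "functionally_compact K" "K \<subseteq> U" and "\<rho> <\<^sub>g 1" "r > 0"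
    and x: "moderate x" "abs_gen x \<in> K"
      "\<And>Z. \<forall>\<^sub>F \<epsilon> in at_right 0. Z \<le> \<bar>mollify \<psi> b (\<lambda>\<phi>. \<phi> 0) \<epsilon> (x \<epsilon>)\<bar>"
    and f: "f (abs_gen x) = r *\<^sub>R abs_gen (\<lambda>\<epsilon>. mollify \<psi> b (\<lambda>\<phi>. \<phi> 0) \<epsilon> (x \<epsilon>))"
  shows "f \<notin> GD_ball K U m \<rho>"
proof
  let ?v = "\<lambda>\<epsilon>. mollify \<psi> b (\<lambda>\<phi>. \<phi> 0) \<epsilon> (x \<epsilon>)"
  assume "f \<in> GD_ball K U m \<rho>"
  then have f': "f \<in> GD K U" "GD_norm K U m f <\<^sub>g \<rho>" unfolding GD_ball_def by auto
  have v: "moderate ?v" using dirac_abs_gen(1)[OF \<psi> x(1)] .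
  have "K \<noteq> {}" using x(2) by blast
  have "\<forall>\<^sub>F \<epsilon> in at_right 0. \<bar>r *\<^sub>R ?v \<epsilon>\<bar> \<le> 2"
    using f scaleR_abs_gen[OF v]
    by (intro GD_norm_less_one_imp_bounded[OF f'(1) K(1) \<open>K \<noteq> {}\<close> K(2) f'(2) \<open>\<rho> <\<^sub>g 1\<close> x(2)] moderate_scaleR v) simp
  \<comment> \<open>The threshold \<open>3 / r\<close> makes the scaled value at least 3, against
    the bound 2.\<close>
  with x(3)[of "3 / r"] have "\<forall>\<^sub>F \<epsilon>::real in at_right 0. False"
    by eventually_elim (use \<open>r > 0\<close> in \<open>auto simp: abs_mult field_simps\<close>)
  then show False by simp
qed

theorem corollary44:
  fixes \<psi> :: "real \<Rightarrow> real^'n::finite \<Rightarrow> real" and b :: "real \<Rightarrow> real"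
  assumes "embedding_mollifier \<psi> b"
  shows "(\<nexists>(\<sigma> :: ((real^'n) gen \<Rightarrow> real gen) topology) U K m \<rho>.
            hausdorff_tvs \<sigma> \<and>
            openin sharp_topology U \<and> functionally_compact K \<and> K \<noteq> {} \<and> K \<subseteq> U \<and>
            topspace \<sigma> \<subseteq> GD K U \<and>
            dirac \<psi> b UNIV \<in> GD K UNIV \<and> dirac \<psi> b U \<in> topspace \<sigma> \<and>
            0 <\<^sub>g \<rho> \<and> \<rho> <\<^sub>g 1 \<and> openin \<sigma> (GD_ball K U m \<rho> \<inter> topspace \<sigma>)) \<and>
         (\<forall>(\<Omega> :: (real^'n) set) (J :: real \<Rightarrow> real) K.
            open \<Omega> \<and> 0 \<in> \<Omega> \<and> moderate J \<and> filterlim J at_top (at_right 0) \<and>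
            K = internal_set (\<lambda>\<epsilon>. {x \<in> \<Omega>. norm x \<le> J \<epsilon>}) \<longrightarrow>
            (\<nexists>(\<sigma> :: ((real^'n) gen \<Rightarrow> real gen) topology) m \<rho>.
               hausdorff_tvs \<sigma> \<and> topspace \<sigma> \<subseteq> colombeau_algebra \<Omega> \<and>
               dirac \<psi> b (compactly_supported_points \<Omega>) \<in> topspace \<sigma> \<and>
               0 <\<^sub>g \<rho> \<and> \<rho> <\<^sub>g 1 \<and> openin \<sigma> (colombeau_ball \<Omega> K m \<rho> \<inter> topspace \<sigma>)))"
proof (intro conjI allI impI notI; elim exE conjE)
  obtain x where x: "moderate x" "\<And>d. d > 0 \<Longrightarrow> \<forall>\<^sub>F \<epsilon> in at_right 0. norm (x \<epsilon>) \<le> d"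
      "\<And>Z. \<forall>\<^sub>F \<epsilon> in at_right 0. Z \<le> \<bar>mollify \<psi> b (\<lambda>\<phi>. \<phi> 0) \<epsilon> (x \<epsilon>)\<bar>"
    by (rule dirac_infinite_point[OF assms], rule that)
  let ?v = "\<lambda>\<epsilon>. mollify \<psi> b (\<lambda>\<phi>. \<phi> 0) \<epsilon> (x \<epsilon>)"
  {
    fix \<sigma> :: "((real^'n) gen \<Rightarrow> real gen) topology" and U K m \<rho>
    assume \<sigma>: "hausdorff_tvs \<sigma>" "dirac \<psi> b U \<in> topspace \<sigma>"
        "openin \<sigma> (GD_ball K U m \<rho> \<inter> topspace \<sigma>)"
      and U: "openin sharp_topology U" and K: "functionally_compact K" "K \<noteq> {}" "K \<subseteq> U"
      and \<delta>: "dirac \<psi> b UNIV \<in> GD K UNIV" and \<rho>: "0 <\<^sub>g \<rho>" "\<rho> <\<^sub>g 1"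
    have "0 \<in> GD_ball K U m \<rho> \<inter> topspace \<sigma>"
      using \<sigma>(1) zero_in_GD_ball[OF U K(2,3) \<rho>(1)] by (simp add: hausdorff_tvs_def subspace_0)
    then obtain r where r: "r > 0" "r *\<^sub>R dirac \<psi> b U \<in> GD_ball K U m \<rho>"
      using hausdorff_tvs_absorbing[OF \<sigma>(1,3) _ \<sigma>(2)] by blast
    \<comment> \<open>The support argument is applied to the delta on the whole space, because the
      class of \<open>x\<close> is known to lie in \<open>U\<close> only once it is known to lie in
      \<open>K\<close>.\<close>
    have "abs_gen x \<in> K"
      by (rule GD_nonvanishing_point_mem[OF \<delta> K(1,2) x(1) dirac_abs_gen(1)[OF assms x(1)]
            dirac_abs_gen(2)[OF assms x(1) UNIV_I] x(3)])
    moreover have "(r *\<^sub>R dirac \<psi> b U) (abs_gen x) = r *\<^sub>R abs_gen ?v"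
      using dirac_abs_gen(2)[OF assms x(1), of U] \<open>abs_gen x \<in> K\<close> K(3) by (auto simp: scaleR_fun_def)
    ultimately show False
      using scaled_dirac_not_in_GD_ball[OF assms K(1,3) \<rho>(2) r(1) x(1) _ x(3)] r(2) by blast
  next
    fix \<Omega> :: "(real^'n) set" and J :: "real \<Rightarrow> real" and K
      and \<sigma> :: "((real^'n) gen \<Rightarrow> real gen) topology" and m \<rho>
    let ?\<Omega>c = "compactly_supported_points \<Omega>"
    assume \<Omega>: "open \<Omega>" "0 \<in> \<Omega>" and J: "moderate J" "filterlim J at_top (at_right 0)"
      and K: "K = internal_set (\<lambda>\<epsilon>. {x \<in> \<Omega>. norm x \<le> J \<epsilon>})"
      and \<sigma>: "hausdorff_tvs \<sigma>" "topspace \<sigma> \<subseteq> colombeau_algebra \<Omega>" "dirac \<psi> b ?\<Omega>c \<in> topspace \<sigma>"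
        "openin \<sigma> (colombeau_ball \<Omega> K m \<rho> \<inter> topspace \<sigma>)"
      and \<rho>: "0 <\<^sub>g \<rho>" "\<rho> <\<^sub>g 1"
    have fcK: "functionally_compact K" unfolding K by (rule functionally_compact_exhaustion[OF J(1)])
    \<comment> \<open>As \<open>x\<close> tends to 0, it eventually enters a compact ball inside
      \<open>\<Omega>\<close> and also the growing sets that form \<open>K\<close>, so membership in
      \<open>K\<close> is direct here.\<close>
    obtain e where e: "e > 0" "cball 0 e \<subseteq> \<Omega>" using \<Omega> open_contains_cball by blast
    have "\<forall>\<^sub>F \<epsilon> in at_right 0. x \<epsilon> \<in> cball 0 e" using x(2)[OF e(1)] by simp
    then have x_in: "abs_gen x \<in> ?\<Omega>c"
      using e(2) x(1) compact_cball unfolding compactly_supported_points_def internal_set_def by blast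
    have "\<forall>\<^sub>F \<epsilon> in at_right 0. e \<le> J \<epsilon>" using J(2) unfolding filterlim_at_top by blast
    with x(2)[OF e(1)] have "\<forall>\<^sub>F \<epsilon> in at_right 0. x \<epsilon> \<in> {x \<in> \<Omega>. norm x \<le> J \<epsilon>}"
      by eventually_elim (use e(2) in auto)
    then have x_K: "abs_gen x \<in> K" unfolding K internal_set_def using x(1) by blast
    then have "0 \<in> GD_ball K UNIV m \<rho>"
      by (intro zero_in_GD_ball openin_sharp_topology_UNIV \<rho>) auto
    moreover have "gsf_restrict ?\<Omega>c 0 = 0" by (simp add: gsf_restrict_def fun_eq_iff)
    moreover have "0 \<in> topspace \<sigma>" using \<sigma>(1) by (simp add: hausdorff_tvs_def subspace_0)
    ultimately have "0 \<in> colombeau_ball \<Omega> K m \<rho> \<inter> topspace \<sigma>"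
      using \<sigma>(2) unfolding colombeau_ball_def by blast
    then obtain r where r: "r > 0" "r *\<^sub>R dirac \<psi> b ?\<Omega>c \<in> colombeau_ball \<Omega> K m \<rho>"
      using hausdorff_tvs_absorbing[OF \<sigma>(1,4) _ \<sigma>(3)] by blast
    then obtain g where g: "g \<in> GD_ball K UNIV m \<rho>" "gsf_restrict ?\<Omega>c g = r *\<^sub>R dirac \<psi> b ?\<Omega>c"
      unfolding colombeau_ball_def by blast
    \<comment> \<open>The extension \<open>g\<close> is unknown in general, but at a compactly
      supported point it must agree with the multiple of the delta.\<close>
    have "g (abs_gen x) = gsf_restrict ?\<Omega>c g (abs_gen x)" using x_in by (simp add: gsf_restrict_def)
    also have "\<dots> = r *\<^sub>R abs_gen ?v"
      using dirac_abs_gen(2)[OF assms x(1) x_in] by (simp add: g(2) scaleR_fun_def)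
    finally show False
      using scaled_dirac_not_in_GD_ball[OF assms fcK subset_UNIV \<rho>(2) r(1) x(1) x_K x(3)] g(1) by blast
  }
qed

end
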